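(* Let $t\ge1$, let $M_1,\dots,M_t$ be nonsingular matrices from $\mathbb{Z}^{2\times2}$ and let $\mathcal{S}_1,\dots,\mathcal{S}_t$ be regular subsets of $\mathrm{GL}(2,\mathbb{Z})$ (given by finite automata). Then it is decidable whether there exist $A_1\in\mathcal{S}_1,\dots,A_t\in\mathcal{S}_t$ such that $A_1M_1A_2M_2\cdots A_{t-1}M_{t-1}A_t=M_t$.
   Context: $\mathrm{GL}(2,\mathbb{Z})$ is the group of $2\times 2$ integer matrices with determinant $\pm1$. Let $\Sigma=\{X,N,S,R\}$ and $\phi:\Sigma^*\to\mathrm{GL}(2,\mathbb{Z})$ the monoid morphism determined by $\phi(X)=\begin{bmatrix}-1&0\\0&-1\end{bmatrix}$, $\phi(N)=\begin{bmatrix}1&0\\0&-1\end{bmatrix}$, $\phi(S)=\begin{bmatrix}0&-1\\1&0\end{bmatrix}$, $\phi(R)=\begin{bmatrix}0&-1\\1&1\end{bmatrix}$. A subset $\mathcal{S}\subseteq\mathrm{GL}(2,\mathbb{Z})$ is regular if $\mathcal{S}=\phi(L)$ for some regular language $L\subseteq\Sigma^*$. *)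

theory Defs
  imports "HOL-Analysis.Determinants" "HOL-Library.Nat_Bijection"
begin

text \<open>
  \<open>recursive n f\<close>: the restriction of \<open>f\<close> to argument lists of length \<open>n\<close> is a total recursive
  function of arity \<open>n\<close>. Minimization is applied to regular functions only, so everything stays
  total. Values on lists of any other length are irrelevant and never used: every rule evaluates
  its constituents at lists of their own arity.
\<close>

inductive recursive :: "nat \<Rightarrow> (nat list \<Rightarrow> nat) \<Rightarrow> bool" where
  zero: "recursive n (\<lambda>xs. 0)"
| succ: "recursive 1 (\<lambda>xs. Suc (xs ! 0))"
| proj: "i < n \<Longrightarrow> recursive n (\<lambda>xs. xs ! i)"
| comp: "recursive (length fs) g \<Longrightarrow> \<forall>f\<in>set fs. recursive n f \<Longrightarrow>
    recursive n (\<lambda>xs. g (map (\<lambda>f. f xs) fs))"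
| prim_rec: "recursive n g \<Longrightarrow> recursive (n + 2) h \<Longrightarrow>
    recursive (n + 1) (\<lambda>xs. rec_nat (g (tl xs)) (\<lambda>k r. h (k # r # tl xs)) (hd xs))"
| minimize: "recursive (n + 1) f \<Longrightarrow> (\<And>xs. length xs = n \<Longrightarrow> \<exists>y. f (y # xs) = 0) \<Longrightarrow>
    recursive n (\<lambda>xs. LEAST y. f (y # xs) = 0)"

definition decidable_set :: "nat set \<Rightarrow> bool" where
  "decidable_set A \<longleftrightarrow> (\<exists>f. recursive 1 f \<and> (\<forall>n. f [n] = (if n \<in> A then 1 else 0)))"

type_synonym mat2 = "int^2^2"

definition mat2 :: "int \<Rightarrow> int \<Rightarrow> int \<Rightarrow> int \<Rightarrow> mat2" where
  "mat2 a b c d = vector [vector [a, b], vector [c, d]]"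

definition mat_prod :: "mat2 list \<Rightarrow> mat2" where
  "mat_prod Ms = foldr (**) Ms (mat 1)"

definition GL2Z :: "mat2 set" where
  "GL2Z = {A. det A = 1 \<or> det A = -1}"

datatype letter = LX | LN | LS | LR

primrec letter_mat :: "letter \<Rightarrow> mat2" where
  "letter_mat LX = mat2 (-1) 0 0 (-1)"
| "letter_mat LN = mat2 1 0 0 (-1)"
| "letter_mat LS = mat2 0 (-1) 1 0"
| "letter_mat LR = mat2 0 (-1) 1 1"

definition phi :: "letter list \<Rightarrow> mat2" where
  "phi w = mat_prod (map letter_mat w)"

text \<open>
  Nondeterministic finite automata without \<open>\<epsilon>\<close>-transitions. States are natural numbers; the finite
  state set is implicit, consisting of the states that are listed.
\<close>

datatype nfa =
  NFA (initials: "nat list") (edges: "(nat \<times> letter \<times> nat) list") (finals: "nat list")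

primrec run :: "nfa \<Rightarrow> nat \<Rightarrow> letter list \<Rightarrow> nat \<Rightarrow> bool" where
  "run \<A> p [] q \<longleftrightarrow> p = q"
| "run \<A> p (a # w) q \<longleftrightarrow> (\<exists>r. (p, a, r) \<in> set (edges \<A>) \<and> run \<A> r w q)"

definition language :: "nfa \<Rightarrow> letter list set" where
  "language \<A> = {w. \<exists>p\<in>set (initials \<A>). \<exists>q\<in>set (finals \<A>). run \<A> p w q}"

definition regular_language :: "letter list set \<Rightarrow> bool" where
  "regular_language L \<longleftrightarrow> (\<exists>\<A>. L = language \<A>)"

definition regular_subset :: "mat2 set \<Rightarrow> bool" where
  "regular_subset T \<longleftrightarrow> (\<exists>L. regular_language L \<and> T = phi ` L)"

definition nfa_subset :: "nfa \<Rightarrow> mat2 set" where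
  "nfa_subset \<A> = phi ` language \<A>"

lemma regular_subset_iff: "regular_subset T \<longleftrightarrow> (\<exists>\<A>. T = nfa_subset \<A>)"
  by (auto simp: regular_subset_def regular_language_def nfa_subset_def)

lemma mat_prod_append: "mat_prod (Ms @ Ns) = mat_prod Ms ** mat_prod Ns"
  by (induction Ms) (simp_all add: mat_prod_def matrix_mul_assoc)

lemma phi_append: "phi (v @ w) = phi v ** phi w"
  by (simp add: phi_def mat_prod_append)

lemma phi_letter: "phi [a] = letter_mat a"
  by (simp add: phi_def mat_prod_def)

lemma letter_mat_in_GL2Z: "letter_mat a \<in> GL2Z"
  by (cases a) (simp_all add: GL2Z_def mat2_def det_2)

lemma phi_in_GL2Z: "phi w \<in> GL2Z"
proof (induction w)
  case Nil
  show ?case by (simp add: phi_def mat_prod_def GL2Z_def det_I)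
next
  case (Cons a w)
  have "phi (a # w) = letter_mat a ** phi w"
    using phi_append[of "[a]" w] by (simp add: phi_letter)
  then show ?case
    using Cons letter_mat_in_GL2Z[of a] by (auto simp: GL2Z_def det_mul)
qed

lemma regular_subset_GL2Z: "regular_subset T \<Longrightarrow> T \<subseteq> GL2Z"
  using phi_in_GL2Z by (auto simp: regular_subset_def)

text \<open>
  An instance is the list of the pairs \<open>(\<A>\<^sub>i, M\<^sub>i)\<close>, \<open>1 \<le> i \<le> t\<close>, where \<open>\<A>\<^sub>i\<close> presents the \<open>i\<close>-th
  regular subset; \<open>t\<close> is its length and hence part of the input.
\<close>

type_synonym inst = "(nfa \<times> mat2) list"

text \<open>
  Indices start at 0 here, so the right-hand side \<open>M (t - 1)\<close> is the last matrix of the instance.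
\<close>

definition solution :: "inst \<Rightarrow> (nat \<Rightarrow> mat2) \<Rightarrow> bool" where
  "solution x A \<longleftrightarrow>
    (let t = length x; M = (\<lambda>i. snd (x ! i)) in
      (\<forall>i<t. A i \<in> nfa_subset (fst (x ! i))) \<and>
      mat_prod (map (\<lambda>i. A i ** M i) [0..<t - 1]) ** A (t - 1) = M (t - 1))"

primrec letter_code :: "letter \<Rightarrow> nat" where
  "letter_code LX = 0"
| "letter_code LN = 1"
| "letter_code LS = 2"
| "letter_code LR = 3"

definition edge_code :: "nat \<times> letter \<times> nat \<Rightarrow> nat" where
  "edge_code = (\<lambda>(p, a, q). prod_encode (p, prod_encode (letter_code a, q)))"

definition nfa_code :: "nfa \<Rightarrow> nat" where
  "nfa_code \<A> = prod_encode (list_encode (initials \<A>),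
     prod_encode (list_encode (map edge_code (edges \<A>)), list_encode (finals \<A>)))"

definition mat_code :: "mat2 \<Rightarrow> nat" where
  "mat_code M = list_encode (map int_encode [M$1$1, M$1$2, M$2$1, M$2$2])"

definition inst_code :: "inst \<Rightarrow> nat" where
  "inst_code x = list_encode (map (\<lambda>(\<A>, M). prod_encode (nfa_code \<A>, mat_code M)) x)"

lemma inj_letter_code: "inj letter_code"
proof (rule injI)
  fix a b assume "letter_code a = letter_code b"
  then show "a = b" by (cases a; cases b) simp_all
qed

lemma inj_edge_code: "inj edge_code"
  by (auto simp: inj_def edge_code_def prod_encode_eq dest: injD[OF inj_letter_code])

lemma inj_nfa_code: "inj nfa_code"
proof (rule injI)
  fix \<A> \<B> assume "nfa_code \<A> = nfa_code \<B>"
  then show "\<A> = \<B>"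
    by (cases \<A>; cases \<B>)
      (simp add: nfa_code_def prod_encode_eq list_encode_eq inj_map_eq_map[OF inj_edge_code])
qed

lemma inj_mat_code: "inj mat_code"
  by (simp add: inj_def mat_code_def list_encode_eq int_encode_eq vec_eq_iff forall_2)

lemma inj_inst_code: "inj inst_code"
proof -
  have "inj (\<lambda>(\<A>, M). prod_encode (nfa_code \<A>, mat_code M))"
    by (auto simp: inj_def prod_encode_eq dest: injD[OF inj_nfa_code] injD[OF inj_mat_code])
  then show ?thesis
    by (simp add: inj_def inst_code_def list_encode_eq inj_map_eq_map)
qed

end

(*
  An instance becomes a finite graph whose edges carry nonsingular integer matrices; the question is
  whether some path has product T. A path is a certificate for "yes", so by searching for both kinds of
  certificates at once it suffices to certify "no" as well.

  GL(2,Z) is the amalgam of its signed permutation matrices A (order 8) and of a dihedral group B of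
  order 12 over A \<inter> B. By the normal form theorem, a product of at least two elements of F = A \<union> B that
  again lies in F has two neighbouring factors whose product lies in F; so it can be evaluated by
  multiplying neighbours without ever leaving the finite set F.

  Consider the configurations (p, K) with p a vertex and K an integer matrix, and the relations
  "some path from p to q has a product g with g K' = K f" with f in F. A "no" certificate is a finite
  family of such triples that contains all edges and all right multiplications by F between
  configurations with K of norm at most D, and is closed under composition with labels in F, but does
  not relate (s, T) to (q, 1) with label 1. To see that it refutes every path of product T, follow
  the path and replace each remaining product K by a Gauss-reduced matrix in K GL(2,Z). The determinant
  of K divides that of T, so reduced matrices have bounded norm and D can be chosen such that the whole
  walk stays within norm D; its labels lie in F and have product 1, so they collapse to label 1.
*)
theory Submission
  imports Defs
begin

section \<open>Computable functions on encoded types\<close>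

text \<open>
  Argument lists of the wrong length carry junk values, hence functions are only compared on lists of
  length \<open>n\<close>.
\<close>

definition rc :: "nat \<Rightarrow> (nat list \<Rightarrow> nat) \<Rightarrow> bool" where
  "rc n f \<longleftrightarrow> (\<exists>g. recursive n g \<and> (\<forall>xs. length xs = n \<longrightarrow> g xs = f xs))"

lemma rcI: "recursive n f \<Longrightarrow> rc n f"
  by (auto simp: rc_def)

lemma rc_comp:
  assumes "rc (length fs) g" "\<forall>f\<in>set fs. rc n f"
  shows "rc n (\<lambda>xs. g (map (\<lambda>f. f xs) fs))"
proof -
  obtain g' where g': "recursive (length fs) g'" "\<And>xs. length xs = length fs \<Longrightarrow> g' xs = g xs"
    using assms(1) by (auto simp: rc_def)
  have "\<forall>f\<in>set fs. \<exists>f'. recursive n f' \<and> (\<forall>xs. length xs = n \<longrightarrow> f' xs = f xs)"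
    using assms(2) by (auto simp: rc_def)
  then obtain F where F: "\<And>f. f \<in> set fs \<Longrightarrow> recursive n (F f)"
    "\<And>f xs. f \<in> set fs \<Longrightarrow> length xs = n \<Longrightarrow> F f xs = f xs"
    by metis
  have "recursive n (\<lambda>xs. g' (map (\<lambda>f. f xs) (map F fs)))"
    using g'(1) F(1) by (intro recursive.comp) auto
  moreover have "g' (map (\<lambda>f. f xs) (map F fs)) = g (map (\<lambda>f. f xs) fs)" if "length xs = n" for xs
    using F(2)[OF _ that] g'(2)[of "map (\<lambda>f. f xs) fs"] by (simp add: comp_def cong: map_cong)
  ultimately show ?thesis
    unfolding rc_def by blast
qed

lemma rc_comp1: "rc 1 g \<Longrightarrow> rc n a \<Longrightarrow> rc n (\<lambda>xs. g [a xs])"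
  using rc_comp[of "[a]" g n] by simp

lemma rc_comp2: "rc 2 g \<Longrightarrow> rc n a \<Longrightarrow> rc n b \<Longrightarrow> rc n (\<lambda>xs. g [a xs, b xs])"
  using rc_comp[of "[a, b]" g n] by (simp add: numeral_2_eq_2)

lemma rc_proj: "i < n \<Longrightarrow> rc n (\<lambda>xs. xs ! i)"
  by (rule rcI) (rule recursive.proj)

lemma rc_Suc: "rc n a \<Longrightarrow> rc n (\<lambda>xs. Suc (a xs))"
  using rc_comp1[OF rcI[OF recursive.succ], of n a] by simp

lemma rc_const: "rc n (\<lambda>xs. c)"
  by (induction c) (use rcI[OF recursive.zero] rc_Suc in auto)

text \<open>One parameter \<open>b\<close> is enough, since several parameters can be packed into a
  single number by pairing.\<close>

lemma rc_rec_nat: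
  assumes g: "rc 1 (\<lambda>xs. g (xs ! 0))" and h: "rc 3 (\<lambda>xs. h (xs ! 0) (xs ! 1) (xs ! 2))"
    and a: "rc n a" and b: "rc n b"
  shows "rc n (\<lambda>xs. rec_nat (g (b xs)) (\<lambda>k r. h k r (b xs)) (a xs))"
proof -
  obtain g' where g': "recursive 1 g'" "\<And>x. g' [x] = g x"
    using g by (auto simp: rc_def)
  obtain h' where h': "recursive 3 h'" "\<And>k r x. h' [k, r, x] = h k r x"
  proof -
    obtain h' where h1: "recursive 3 h'"
      "\<And>xs. length xs = 3 \<longrightarrow> h' xs = h (xs ! 0) (xs ! 1) (xs ! 2)"
      using h by (auto simp: rc_def)
    show ?thesis
      by (rule that[OF h1(1)]) (use h1(2) in \<open>simp add: numeral_2_eq_2 numeral_3_eq_3\<close>)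
  qed
  have "recursive (1 + 1) (\<lambda>xs. rec_nat (g' (tl xs)) (\<lambda>k r. h' (k # r # tl xs)) (hd xs))"
    using g'(1) h'(1) by (intro recursive.prim_rec) (simp_all add: numeral_3_eq_3)
  then have "rc 2 (\<lambda>xs. rec_nat (g' (tl xs)) (\<lambda>k r. h' (k # r # tl xs)) (hd xs))"
    by (intro rcI) (simp add: numeral_2_eq_2)
  from rc_comp2[OF this a b] show ?thesis
    by (simp add: g' h')
qed

lemma rc_Least:
  assumes f: "rc 2 (\<lambda>xs. f (xs ! 0) (xs ! 1))" and ex: "\<And>x. \<exists>y. f y x = 0" and a: "rc n a"
  shows "rc n (\<lambda>xs. LEAST y. f y (a xs) = 0)"
proof -
  obtain f' where f': "recursive 2 f'" "\<And>xs. length xs = 2 \<longrightarrow> f' xs = f (xs ! 0) (xs ! 1)"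
    using f by (auto simp: rc_def)
  then have f'': "f' [y, x] = f y x" for x y
    by simp
  have "recursive 1 (\<lambda>xs. LEAST y. f' (y # xs) = 0)"
  proof (rule recursive.minimize)
    show "recursive (1 + 1) f'"
      using f'(1) by (simp add: numeral_2_eq_2)
    show "\<exists>y. f' (y # xs) = 0" if "length xs = 1" for xs
      using that ex[of "hd xs"] by (cases xs) (auto simp: f'')
  qed
  from rc_comp1[OF rcI[OF this] a] show ?thesis
    by (simp add: f'')
qed

section \<open>Arithmetic and the pairing function\<close>

lemma rc_add: "rc n a \<Longrightarrow> rc n b \<Longrightarrow> rc n (\<lambda>xs. a xs + b xs)"
proof -
  assume ab: "rc n a" "rc n b"
  have "rec_nat y (\<lambda>k r. Suc r) x = x + y" for x y :: nat
    by (induction x) auto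
  then show ?thesis
    using rc_rec_nat[of "\<lambda>x. x" "\<lambda>k r x. Suc r", OF _ _ ab] by (simp add: rc_proj rc_Suc)
qed

lemma rc_mult: "rc n a \<Longrightarrow> rc n b \<Longrightarrow> rc n (\<lambda>xs. a xs * b xs)"
proof -
  assume ab: "rc n a" "rc n b"
  have "rec_nat 0 (\<lambda>k r. r + y) x = x * y" for x y :: nat
    by (induction x) auto
  then show ?thesis
    using rc_rec_nat[of "\<lambda>x. 0" "\<lambda>k r x. r + x", OF _ _ ab] by (simp add: rc_proj rc_add rc_const)
qed

lemma rc_pred: "rc n a \<Longrightarrow> rc n (\<lambda>xs. a xs - 1)"
proof -
  assume a: "rc n a"
  have "rec_nat 0 (\<lambda>k r. k) x = x - 1" for x :: nat
    by (cases x) auto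
  then show ?thesis
    using rc_rec_nat[of "\<lambda>x. 0" "\<lambda>k r x. k", OF _ _ a a] by (simp add: rc_proj rc_const)
qed

lemma rc_diff: "rc n a \<Longrightarrow> rc n b \<Longrightarrow> rc n (\<lambda>xs. a xs - b xs)"
proof -
  assume ab: "rc n b" "rc n a"
  have "rec_nat y (\<lambda>k r. r - 1) x = y - x" for x y :: nat
    by (induction x) auto
  then show ?thesis
    using rc_rec_nat[of "\<lambda>x. x" "\<lambda>k r x. r - 1", OF _ _ ab] rc_pred[OF rc_proj[of 1 3]]
    by (simp add: rc_proj)
qed

lemma rc_triangle: "rc n a \<Longrightarrow> rc n (\<lambda>xs. triangle (a xs))"
proof -
  assume a: "rc n a"
  have "rec_nat 0 (\<lambda>k r. r + Suc k) x = triangle x" for x :: nat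
    by (induction x) (auto simp: triangle_Suc)
  then show ?thesis
    using rc_rec_nat[of "\<lambda>x. 0" "\<lambda>k r x. r + Suc k", OF _ _ a a] rc_add[OF rc_proj[of 1 3] rc_Suc[OF rc_proj[of 0 3]]]
    by (simp add: rc_proj rc_const)
qed

lemma rc_prod_encode: "rc n a \<Longrightarrow> rc n b \<Longrightarrow> rc n (\<lambda>xs. prod_encode (a xs, b xs))"
  by (simp add: prod_encode_def rc_add rc_triangle)

lemma triangle_mono: "m \<le> n \<Longrightarrow> triangle m \<le> triangle n"
  by (induction n) (auto simp: le_Suc_eq triangle_Suc)

text \<open>The pairing function numbers the diagonals one after the other: diagonal
  \<open>s\<close> occupies the numbers from \<open>triangle s\<close> up to, but excluding,
  \<open>triangle (Suc s)\<close>. Truncated subtraction turns "below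
  \<open>triangle (Suc s)\<close>" into a zero test, so minimization recovers the diagonal
  \<open>i + j\<close>, and with it both components.\<close>

lemma Least_triangle: "(LEAST s. Suc (prod_encode (i, j)) - triangle (Suc s) = 0) = i + j"
proof (rule Least_equality)
  show "Suc (prod_encode (i, j)) - triangle (Suc (i + j)) = 0"
    by (simp add: prod_encode_def triangle_Suc)
next
  fix s assume *: "Suc (prod_encode (i, j)) - triangle (Suc s) = 0"
  show "i + j \<le> s"
  proof (rule ccontr)
    assume "\<not> i + j \<le> s"
    then have "triangle (Suc s) \<le> triangle (i + j)"
      by (intro triangle_mono) auto
    with * show False
      by (simp add: prod_encode_def)
  qed
qed

lemma rc_prod_decode:
  assumes "rc n a"
  shows "rc n (\<lambda>xs. fst (prod_decode (a xs)))" "rc n (\<lambda>xs. snd (prod_decode (a xs)))"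
proof -
  let ?s = "\<lambda>x. LEAST s. Suc x - triangle (Suc s) = 0"
  have ex: "\<exists>s. Suc x - triangle (Suc s) = 0" for x
    by (rule exI[of _ x]) (simp add: triangle_Suc)
  have s: "rc n (\<lambda>xs. ?s (a xs))"
    by (rule rc_Least[of "\<lambda>s x. Suc x - triangle (Suc s)", OF _ ex assms])
      (intro rc_diff rc_Suc rc_triangle rc_proj; simp)
  have eq: "fst (prod_decode x) = x - triangle (?s x)"
    "snd (prod_decode x) = ?s x - (x - triangle (?s x))" for x
  proof -
    obtain i j where x: "prod_decode x = (i, j)" by fastforce
    then have x': "x = prod_encode (i, j)"
      by (metis prod_decode_inverse)
    show "fst (prod_decode x) = x - triangle (?s x)"
      "snd (prod_decode x) = ?s x - (x - triangle (?s x))"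
      unfolding x' Least_triangle prod_encode_inverse by (simp_all add: prod_encode_def)
  qed
  show "rc n (\<lambda>xs. fst (prod_decode (a xs)))" "rc n (\<lambda>xs. snd (prod_decode (a xs)))"
    unfolding eq by (intro rc_diff rc_triangle assms s)+
qed

section \<open>Computability on types with bijective codes\<close>

class enc =
  fixes enc :: "'a \<Rightarrow> nat"
  assumes bij_enc: "bij enc"

definition dec :: "nat \<Rightarrow> 'a::enc" where
  "dec = inv enc"

lemma dec_enc [simp]: "dec (enc x) = x"
  by (simp add: dec_def bij_enc bij_is_inj)

lemma enc_dec [simp]: "enc (dec n :: 'a::enc) = n"
  unfolding dec_def by (meson bij_enc bij_inv_eq_iff)

lemma enc_eq_iff [simp]: "enc x = enc y \<longleftrightarrow> x = y"
  by (metis dec_enc)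

instantiation nat :: enc
begin
definition "enc_nat = (\<lambda>n::nat. n)"
instance by standard (auto simp: enc_nat_def intro: bijI)
end

instantiation int :: enc
begin
definition "enc_int = int_encode"
instance by standard (simp add: enc_int_def bij_int_encode)
end

instantiation prod :: (enc, enc) enc
begin
definition "enc_prod = (\<lambda>p::'a \<times> 'b. prod_encode (enc (fst p), enc (snd p)))"
instance
proof
  show "bij (enc :: 'a \<times> 'b \<Rightarrow> nat)"
    by (rule bij_betw_byWitness[where f' = "\<lambda>n. (dec (fst (prod_decode n)), dec (snd (prod_decode n)))"])
      (auto simp: enc_prod_def)
qed
end

instantiation list :: (enc) enc
begin
definition "enc_list = (\<lambda>xs::'a list. list_encode (map enc xs))"
instance
proof
  show "bij (enc :: 'a list \<Rightarrow> nat)"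
    by (rule bij_betw_byWitness[where f' = "\<lambda>n. map dec (list_decode n)"])
      (auto simp: enc_list_def comp_def)
qed
end

lemma dec_nat [simp]: "(dec n :: nat) = n"
  using enc_dec[of n, where 'a = nat] by (simp add: enc_nat_def)

text \<open>As codes are bijective, every number is the code of exactly one value. There are no junk
  inputs, and a search through the numbers is a search through all values of the type.\<close>

definition Comp :: "('a::enc \<Rightarrow> 'b::enc) \<Rightarrow> bool" where
  "Comp f \<longleftrightarrow> rc 1 (\<lambda>xs. enc (f (dec (xs ! 0))))"

definition Dec :: "('a::enc \<Rightarrow> bool) \<Rightarrow> bool" where
  "Dec P \<longleftrightarrow> Comp (\<lambda>x. if P x then 1 else 0 :: nat)"

named_theorems computable

lemma Comp_comp: "Comp f \<Longrightarrow> Comp g \<Longrightarrow> Comp (\<lambda>x. f (g x))"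
  using rc_comp1[of "\<lambda>xs. enc (f (dec (xs ! 0)))" 1 "\<lambda>xs. enc (g (dec (xs ! 0)))"]
  by (simp add: Comp_def)

lemma Comp_id [computable]: "Comp (\<lambda>x. x)"
  by (simp add: Comp_def rc_proj)

lemma Comp_const [computable]: "Comp (\<lambda>x. c)"
  by (simp add: Comp_def rc_const)

lemma Comp_Pair [computable]: "Comp f \<Longrightarrow> Comp g \<Longrightarrow> Comp (\<lambda>x. (f x, g x))"
  by (simp add: Comp_def enc_prod_def rc_prod_encode)

lemma fst_dec: "fst (dec n :: 'a::enc \<times> 'b::enc) = dec (fst (prod_decode n))"
  and snd_dec: "snd (dec n :: 'a \<times> 'b) = dec (snd (prod_decode n))"
proof -
  have n: "n = prod_encode (enc (fst (dec n :: 'a \<times> 'b)), enc (snd (dec n :: 'a \<times> 'b)))"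
    using enc_dec[of n, where 'a = "'a \<times> 'b"] by (simp only: enc_prod_def)
  have *: "prod_decode n = (enc (fst (dec n :: 'a \<times> 'b)), enc (snd (dec n :: 'a \<times> 'b)))"
    using arg_cong[OF n, of prod_decode] by simp
  show "fst (dec n :: 'a \<times> 'b) = dec (fst (prod_decode n))"
    "snd (dec n :: 'a \<times> 'b) = dec (snd (prod_decode n))"
    using * by simp_all
qed

lemma Comp_fst: "Comp (fst :: 'a::enc \<times> 'b::enc \<Rightarrow> 'a)"
  and Comp_snd: "Comp (snd :: 'a::enc \<times> 'b::enc \<Rightarrow> 'b)"
  by (simp_all add: Comp_def fst_dec snd_dec rc_prod_decode rc_proj)

lemmas [computable] = Comp_comp[OF Comp_fst] Comp_comp[OF Comp_snd]

lemma Comp_comp2: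
  assumes "Comp (\<lambda>z. f (fst z) (snd z))" "Comp a" "Comp b"
  shows "Comp (\<lambda>x. f (a x) (b x))"
  using Comp_comp[OF assms(1) Comp_Pair[OF assms(2,3)]] by simp

lemma Comp_comp3:
  assumes "Comp (\<lambda>z. f (fst z) (fst (snd z)) (snd (snd z)))" "Comp a" "Comp b" "Comp c"
  shows "Comp (\<lambda>x. f (a x) (b x) (c x))"
  using Comp_comp[OF assms(1) Comp_Pair[OF assms(2) Comp_Pair[OF assms(3,4)]]] by simp

lemma Comp_Suc [computable]: "Comp f \<Longrightarrow> Comp (\<lambda>x. Suc (f x))"
  by (simp add: Comp_def enc_nat_def rc_Suc)

lemma Comp_add_nat [computable]: "Comp f \<Longrightarrow> Comp g \<Longrightarrow> Comp (\<lambda>x. f x + g x :: nat)"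
  by (simp add: Comp_def enc_nat_def rc_add)

lemma Comp_mult_nat [computable]: "Comp f \<Longrightarrow> Comp g \<Longrightarrow> Comp (\<lambda>x. f x * g x :: nat)"
  by (simp add: Comp_def enc_nat_def rc_mult)

lemma Comp_diff_nat [computable]: "Comp f \<Longrightarrow> Comp g \<Longrightarrow> Comp (\<lambda>x. f x - g x :: nat)"
  by (simp add: Comp_def enc_nat_def rc_diff)

lemma Comp_enc [computable]: "Comp f \<Longrightarrow> Comp (\<lambda>x. enc (f x))"
  unfolding Comp_def by (simp add: enc_nat_def)

lemma Comp_dec [computable]: "Comp f \<Longrightarrow> Comp (\<lambda>x. dec (f x))"
  unfolding Comp_def by (simp add: enc_nat_def)

lemma Comp_rec_nat [computable]:
  fixes h :: "'a::enc \<Rightarrow> nat \<Rightarrow> 'b::enc \<Rightarrow> 'b"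
  assumes a: "Comp a" and h: "Comp (\<lambda>z. h (fst z) (fst (snd z)) (snd (snd z)))" and n: "Comp n"
  shows "Comp (\<lambda>x. rec_nat (a x) (h x) (n x))"
proof -
  let ?g = "\<lambda>x. enc (a (dec x))" and ?h = "\<lambda>k r x. enc (h (dec x) k (dec r))"
  have h': "rc 3 (\<lambda>xs. ?h (xs ! 0) (xs ! 1) (xs ! 2))"
    using rc_comp1[OF h[unfolded Comp_def], of 3 "\<lambda>xs. prod_encode (xs ! 2, prod_encode (xs ! 0, xs ! 1))"]
    by (simp add: rc_prod_encode rc_proj fst_dec snd_dec)
  have "rc 1 (\<lambda>xs. rec_nat (?g (xs ! 0)) (\<lambda>k r. ?h k r (xs ! 0)) (n (dec (xs ! 0))))"
    using a n by (intro rc_rec_nat[OF _ h']) (simp_all add: Comp_def rc_proj enc_nat_def)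
  moreover have "rec_nat (enc (a y)) (\<lambda>k r. enc (h y k (dec r))) m = enc (rec_nat (a y) (h y) m)" for y m
    by (induction m) auto
  ultimately show ?thesis
    by (simp add: Comp_def)
qed

lemma Comp_If [computable]:
  assumes "Dec P" "Comp a" "Comp b"
  shows "Comp (\<lambda>x. if P x then a x else b x)"
proof -
  \<comment> \<open>A recursion of length 0 or 1 selects between the two branches.\<close>
  have "Comp (\<lambda>x. rec_nat (b x) (\<lambda>_ _. a x) (if P x then 1 else 0))"
    by (intro computable assms Comp_comp[OF assms(2)] assms(1)[unfolded Dec_def])
  moreover have "rec_nat (b x) (\<lambda>_ _. a x) (if P x then 1 else 0) = (if P x then a x else b x)" for x
    by simp
  ultimately show ?thesis by simp
qed

lemma Dec_comp: "Dec P \<Longrightarrow> Comp f \<Longrightarrow> Dec (\<lambda>x. P (f x))"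
  unfolding Dec_def by (rule Comp_comp)

lemma Dec_comp2:
  assumes "Dec (\<lambda>z. P (fst z) (snd z))" "Comp a" "Comp b"
  shows "Dec (\<lambda>x. P (a x) (b x))"
  using Dec_comp[OF assms(1) Comp_Pair[OF assms(2,3)]] by simp

lemma Dec_le_nat [computable]: "Comp f \<Longrightarrow> Comp g \<Longrightarrow> Dec (\<lambda>x. (f x :: nat) \<le> g x)"
proof -
  assume "Comp f" "Comp g"
  then have "Comp (\<lambda>x. 1 - (f x - g x))"
    by (intro computable)
  moreover have "1 - (m - n) = (if m \<le> n then 1 else 0)" for m n :: nat
    by simp
  ultimately show ?thesis
    by (simp add: Dec_def)
qed

lemma Dec_const [computable]: "Dec (\<lambda>x. c)"
  by (simp add: Dec_def Comp_const)

lemma Dec_conj [computable]: "Dec P \<Longrightarrow> Dec Q \<Longrightarrow> Dec (\<lambda>x. P x \<and> Q x)"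
proof -
  assume "Dec P" "Dec Q"
  then have "Comp (\<lambda>x. (if P x then 1 else 0) * (if Q x then 1 else 0 :: nat))"
    by (intro computable)
  moreover have "(if p then 1 else 0) * (if q then 1 else 0 :: nat) = (if p \<and> q then 1 else 0)" for p q
    by simp
  ultimately show ?thesis
    by (simp add: Dec_def)
qed

lemma Dec_not [computable]: "Dec P \<Longrightarrow> Dec (\<lambda>x. \<not> P x)"
proof -
  assume "Dec P"
  then have "Comp (\<lambda>x. 1 - (if P x then 1 else 0 :: nat))"
    by (intro computable)
  moreover have "1 - (if p then 1 else 0 :: nat) = (if \<not> p then 1 else 0)" for p
    by simp
  ultimately show ?thesis
    by (simp add: Dec_def)
qed

lemma Dec_disj [computable]: "Dec P \<Longrightarrow> Dec Q \<Longrightarrow> Dec (\<lambda>x. P x \<or> Q x)"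
  using Dec_not[OF Dec_conj[OF Dec_not[of P] Dec_not[of Q]]] by simp

lemma Dec_imp [computable]: "Dec P \<Longrightarrow> Dec Q \<Longrightarrow> Dec (\<lambda>x. P x \<longrightarrow> Q x)"
  unfolding imp_conv_disj by (intro Dec_disj Dec_not)

lemma Dec_eq [computable]: "Comp f \<Longrightarrow> Comp g \<Longrightarrow> Dec (\<lambda>x. f x = g x)"
proof -
  assume "Comp f" "Comp g"
  then have "Dec (\<lambda>x. enc (f x) \<le> enc (g x) \<and> enc (g x) \<le> enc (f x))"
    by (intro computable)
  moreover have "enc a \<le> enc b \<and> enc b \<le> enc a \<longleftrightarrow> a = b" for a b :: 'b
    using enc_eq_iff[of a b] by linarith
  ultimately show ?thesis by simp
qed

lemma Dec_less_nat [computable]: "Comp f \<Longrightarrow> Comp g \<Longrightarrow> Dec (\<lambda>x. (f x :: nat) < g x)"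
  using Dec_le_nat[OF Comp_Suc, of f g] by (simp add: Suc_le_eq)

lemma Comp_Least:
  assumes P: "Dec (\<lambda>z. P (fst z) (snd z))" and ex: "\<And>x. \<exists>y. P x y"
  shows "Comp (\<lambda>x. LEAST y::nat. P x y)"
proof -
  let ?f = "\<lambda>y x. if P (dec x) y then 0 else 1 :: nat"
  have "Comp (\<lambda>z. if P (fst z) (snd z) then 0 else 1 :: nat)"
    by (intro computable P)
  from rc_comp1[OF this[unfolded Comp_def], of 2 "\<lambda>xs. prod_encode (xs ! 1, xs ! 0)"]
  have "rc 2 (\<lambda>xs. ?f (xs ! 0) (xs ! 1))"
    by (simp add: rc_prod_encode rc_proj fst_dec snd_dec enc_nat_def)
  then have "rc 1 (\<lambda>xs. LEAST y. ?f y (xs ! 0) = 0)"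
    using ex by (intro rc_Least) (auto simp: rc_proj)
  moreover have "(LEAST y. ?f y x = 0) = (LEAST y. P (dec x) y)" for x
    by (rule arg_cong[of _ _ Least]) auto
  ultimately show ?thesis
    by (simp add: Comp_def enc_nat_def)
qed

text \<open>Post's argument. Each number \<open>n\<close> is read as a candidate \<open>y\<close>
  and as a candidate \<open>z\<close> at the same time. By \<open>iff\<close> the search for the
  least successful \<open>n\<close> always ends, and testing \<open>P\<close> there gives the
  answer: if only \<open>Q\<close> succeeds, then no \<open>y\<close> exists at all.\<close>

lemma Dec_of_two_sided_search:
  fixes P :: "'a::enc \<Rightarrow> 'b::enc \<Rightarrow> bool" and Q :: "'a \<Rightarrow> 'c::enc \<Rightarrow> bool"
  assumes P: "Dec (\<lambda>z. P (fst z) (snd z))" and Q: "Dec (\<lambda>z. Q (fst z) (snd z))"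
    and iff: "\<And>x. (\<exists>y. P x y) \<longleftrightarrow> \<not> (\<exists>z. Q x z)"
  shows "Dec (\<lambda>x. \<exists>y. P x y)"
proof -
  let ?R = "\<lambda>x n. P x (dec n) \<or> Q x (dec n)"
  have R: "Dec (\<lambda>z. ?R (fst z) (snd z))"
    by (intro computable Dec_comp2[OF P] Dec_comp2[OF Q])
  have ex: "\<exists>n. ?R x n" for x
    using iff[of x] by (metis dec_enc)
  have "Dec (\<lambda>x. P x (dec (LEAST n. ?R x n)))"
    by (intro computable Dec_comp2[OF P] Comp_Least[OF R] ex)
  moreover have "P x (dec (LEAST n. ?R x n)) \<longleftrightarrow> (\<exists>y. P x y)" for x
    using LeastI_ex[OF ex[of x]] iff[of x] by blast
  ultimately show ?thesis by simp
qed

lemma decidable_set_Dec: "Dec (\<lambda>n. n \<in> A) \<Longrightarrow> decidable_set A"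
  by (auto simp: Dec_def Comp_def decidable_set_def rc_def enc_nat_def)

section \<open>Lists and bounded quantifiers\<close>

lemma enc_Nil: "enc ([] :: 'a::enc list) = 0"
  and enc_Cons: "enc (x # xs) = Suc (enc (x, xs))"
  by (simp_all add: enc_list_def enc_prod_def)

lemma Comp_Cons [computable]: "Comp f \<Longrightarrow> Comp g \<Longrightarrow> Comp (\<lambda>x. f x # g x)"
proof -
  assume "Comp f" "Comp g"
  then have "Comp (\<lambda>x. dec (Suc (enc (f x, g x))) :: 'b list)"
    by (intro computable)
  then show ?thesis
    by (simp flip: enc_Cons)
qed

lemma Comp_case_list [computable]:
  fixes l :: "'a::enc \<Rightarrow> 'b::enc list"
  assumes l: "Comp l" and a: "Comp a" and b: "Comp (\<lambda>z. b (fst z) (fst (snd z)) (snd (snd z)))"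
  shows "Comp (\<lambda>x. case l x of [] \<Rightarrow> a x | y # ys \<Rightarrow> b x y ys)"
proof -
  \<comment> \<open>The code of a nonempty list is \<open>Suc k\<close>, where \<open>k\<close>
    codes the pair of head and tail. The last step of a recursion along the code thus sees both; the
    recursive value \<open>r\<close> is ignored.\<close>
  let ?h = "\<lambda>x k r. b x (fst (dec k :: 'b \<times> 'b list)) (snd (dec k :: 'b \<times> 'b list))"
  have "Comp (\<lambda>x. rec_nat (a x) (?h x) (enc (l x)))"
    by (intro computable a l Comp_comp3[OF b])
  moreover have "rec_nat (a x) (?h x) (enc (l x)) = (case l x of [] \<Rightarrow> a x | y # ys \<Rightarrow> b x y ys)" for x
    by (cases "l x") (simp_all add: enc_Nil enc_Cons)
  ultimately show ?thesis by simp
qed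

lemma length_le_enc: "length xs \<le> enc xs"
proof (induction xs)
  case (Cons x xs)
  have "enc xs \<le> enc (x, xs)"
    by (simp add: enc_prod_def le_prod_encode_2)
  with Cons show ?case by (simp add: enc_Cons)
qed simp

text \<open>The state consists of the accumulator and the part of the list still to be read. The
  code of a list bounds its length, so iterating that often reads all of it; once the list is
  exhausted, further steps leave the state unchanged.\<close>

lemma Comp_foldl:
  fixes l :: "'a::enc \<Rightarrow> 'b::enc list" and h :: "'a \<Rightarrow> 'c::enc \<Rightarrow> 'b \<Rightarrow> 'c"
  assumes h: "Comp (\<lambda>z. h (fst z) (fst (snd z)) (snd (snd z)))" and a: "Comp a" and l: "Comp l"
  shows "Comp (\<lambda>x. foldl (h x) (a x) (l x))"
proof -
  let ?s = "\<lambda>x k q. case snd q of [] \<Rightarrow> q | y # ys \<Rightarrow> (h x (fst q) y, ys)"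
  have "Comp (\<lambda>x. fst (rec_nat (a x, l x) (?s x) (enc (l x))))"
    by (intro computable a l Comp_comp3[OF h])
  moreover have "fst (rec_nat (s, xs) (?s x) n) = foldl (h x) s xs" if "length xs \<le> n" for x s xs n
  proof -
    \<comment> \<open>\<open>rec_nat\<close> unfolds at its last step, the fold at its first. The
      step function ignores its counter, so the two can be exchanged.\<close>
    have shift: "rec_nat q (?s x) (Suc n) = rec_nat (?s x 0 q) (?s x) n" for q n
      by (induction n) auto
    show ?thesis using that
    proof (induction n arbitrary: s xs)
      case (Suc n)
      then show ?case
        by (cases xs) (simp_all add: shift del: nat.rec(2))
    qed auto
  qed
  ultimately show ?thesis
    by (simp add: length_le_enc)
qed

lemma Comp_rev [computable]: "Comp l \<Longrightarrow> Comp (\<lambda>x. rev (l x))"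
proof -
  assume "Comp l"
  then have "Comp (\<lambda>x. foldl (\<lambda>s y. y # s) [] (l x))"
    by (intro Comp_foldl computable)
  moreover have "foldl (\<lambda>s y. y # s) s xs = rev xs @ s" for s xs :: "'b list"
    by (induction xs arbitrary: s) auto
  ultimately show ?thesis by simp
qed

text \<open>List recursion evaluates from the right, hence the fold over the reversed list. Its
  state also rebuilds the tail already processed, which \<open>h\<close> takes as an
  argument.\<close>

lemma Comp_rec_list [computable]:
  fixes l :: "'a::enc \<Rightarrow> 'b::enc list" and h :: "'a \<Rightarrow> 'b \<Rightarrow> 'b list \<Rightarrow> 'c::enc \<Rightarrow> 'c"
  assumes a: "Comp a"
    and h: "Comp (\<lambda>z. h (fst z) (fst (snd z)) (fst (snd (snd z))) (snd (snd (snd z))))" and l: "Comp l"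
  shows "Comp (\<lambda>x. rec_list (a x) (h x) (l x))"
proof -
  let ?s = "\<lambda>x q y. (y # fst q, h x y (fst q) (snd q))"
  have h': "Comp (\<lambda>z. h (f z) (g z) (k z) (r z))" if "Comp f" "Comp g" "Comp k" "Comp r" 
    for f :: "'d::enc \<Rightarrow> 'a" and g k r
    using Comp_comp[OF h, of "\<lambda>z. (f z, g z, k z, r z)"] that by (simp add: Comp_Pair)
  have "Comp (\<lambda>x. snd (foldl (?s x) ([], a x) (rev (l x))))"
    by (intro Comp_foldl computable a l h')
  moreover have "foldl (?s x) ([], a x) (rev xs) = (xs, rec_list (a x) (h x) xs)" for x xs
    by (induction xs) auto
  ultimately show ?thesis by simp
qed

lemma Dec_ball_set [computable]:
  assumes "Comp l" "Dec (\<lambda>z. P (fst z) (snd z))"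
  shows "Dec (\<lambda>x. \<forall>y\<in>set (l x). P x y)"
proof -
  have "Comp (\<lambda>x. rec_list 1 (\<lambda>y ys r. if P x y then r else (0::nat)) (l x))"
    by (intro computable assms Dec_comp2[OF assms(2)])
  moreover have "rec_list 1 (\<lambda>y ys r. if P x y then r else (0::nat)) xs
      = (if \<forall>y\<in>set xs. P x y then 1 else 0)" for x xs
    by (induction xs) auto
  ultimately show ?thesis
    by (simp add: Dec_def)
qed

lemma Dec_bex_set [computable]:
  assumes "Comp l" "Dec (\<lambda>z. P (fst z) (snd z))"
  shows "Dec (\<lambda>x. \<exists>y\<in>set (l x). P x y)"
  using Dec_not[OF Dec_ball_set[OF assms(1), of "\<lambda>x y. \<not> P x y"]] Dec_not[OF assms(2)] by simp

lemma Dec_in_set [computable]: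
  assumes "Comp a" "Comp l"
  shows "Dec (\<lambda>x. a x \<in> set (l x))"
proof -
  have "Dec (\<lambda>x. \<exists>y\<in>set (l x). a x = y)"
    by (intro computable assms Comp_comp[OF assms(1)])
  then show ?thesis by simp
qed

lemma Dec_all_less [computable]:
  fixes n :: "'a::enc \<Rightarrow> nat"
  assumes "Comp n" "Dec (\<lambda>z. P (fst z) (snd z))"
  shows "Dec (\<lambda>x. \<forall>k<n x. P x k)"
proof -
  have "Comp (\<lambda>x. rec_nat 1 (\<lambda>k r. if P x k then r else (0::nat)) (n x))"
    by (intro computable assms Dec_comp2[OF assms(2)])
  moreover have "rec_nat 1 (\<lambda>k r. if P x k then r else (0::nat)) m
      = (if \<forall>k<m. P x k then 1 else 0)" for x m
    by (induction m) (auto simp: less_Suc_eq)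
  ultimately show ?thesis
    by (simp add: Dec_def)
qed

lemma Comp_length [computable]: "Comp l \<Longrightarrow> Comp (\<lambda>x. length (l x))"
proof -
  assume "Comp l"
  then have "Comp (\<lambda>x. rec_list 0 (\<lambda>y ys r. Suc r) (l x))"
    by (intro computable)
  moreover have "rec_list 0 (\<lambda>y ys r. Suc r) xs = length xs" for xs :: "'b list"
    by (induction xs) auto
  ultimately show ?thesis by simp
qed

lemma Comp_map [computable]:
  assumes "Comp (\<lambda>z. f (fst z) (snd z))" "Comp l"
  shows "Comp (\<lambda>x. map (f x) (l x))"
proof -
  have "Comp (\<lambda>x. rec_list [] (\<lambda>y ys r. f x y # r) (l x))"
    by (intro computable assms Comp_comp2[OF assms(1)])
  moreover have "rec_list [] (\<lambda>y ys r. f x y # r) xs = map (f x) xs" for x xs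
    by (induction xs) auto
  ultimately show ?thesis by simp
qed

lemma Comp_append [computable]: "Comp f \<Longrightarrow> Comp g \<Longrightarrow> Comp (\<lambda>x. f x @ g x)"
proof -
  assume fg: "Comp f" "Comp g"
  then have "Comp (\<lambda>x. rec_list (g x) (\<lambda>y ys r. y # r) (f x))"
    by (intro computable)
  moreover have "rec_list zs (\<lambda>y ys r. y # r) xs = xs @ zs" for xs zs :: "'b list"
    by (induction xs) auto
  ultimately show ?thesis by simp
qed

lemma Comp_concat [computable]: "Comp l \<Longrightarrow> Comp (\<lambda>x. concat (l x))"
proof -
  assume "Comp l"
  then have "Comp (\<lambda>x. rec_list [] (\<lambda>y ys r. y @ r) (l x))"
    by (intro computable)
  moreover have "rec_list [] (\<lambda>y ys r. y @ r) xs = concat xs" for xs :: "'b list list"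
    by (induction xs) auto
  ultimately show ?thesis by simp
qed

section \<open>Integers as differences of positive and negative parts\<close>

lemma Comp_half: "Comp f \<Longrightarrow> Comp (\<lambda>x. f x div 2 :: nat)"
proof -
  assume f: "Comp f"
  have "\<exists>h. n < 2 * h + 2" for n :: nat
    by (rule exI[of _ n]) simp
  then have "Comp (\<lambda>n::nat. LEAST h. n < 2 * h + 2)"
    by (intro Comp_Least computable)
  moreover have "(LEAST h. n < 2 * h + 2) = n div 2" for n :: nat
    by (rule Least_equality) auto
  ultimately have "Comp (\<lambda>n::nat. n div 2)"
    by simp
  from Comp_comp[OF this f] show ?thesis .
qed

text \<open>\<open>int_encode\<close> sends \<open>i\<close> to \<open>2 * i\<close> if
  \<open>i\<close> is nonnegative and to \<open>- 2 * i - 1\<close> otherwise, so the parity of the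
  code is the sign.\<close>

lemma Comp_nat_int [computable]: "Comp f \<Longrightarrow> Comp (\<lambda>x. nat (f x))"
  and Comp_nat_minus_int: "Comp f \<Longrightarrow> Comp (\<lambda>x. nat (- f x))"
proof -
  assume f: "Comp f"
  have *: "nat i = (if 2 * (enc i div 2) = enc i then enc i div 2 else 0)"
    "nat (- i) = (if 2 * (enc i div 2) = enc i then 0 else Suc (enc i div 2))" for i
    by (auto simp: enc_int_def int_encode_def sum_encode_def; presburger)+
  show "Comp (\<lambda>x. nat (f x))" "Comp (\<lambda>x. nat (- f x))"
    by (simp_all only: *(1)[of "f x" for x] *(2)[of "f x" for x]) (intro computable f Comp_half)+
qed

lemma Comp_diff_of_nat:
  assumes "Comp f" "Comp g"
  shows "Comp (\<lambda>x. int (f x) - int (g x))"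
proof -
  have "Comp (\<lambda>x. dec (if g x \<le> f x then 2 * (f x - g x) else Suc (2 * (g x - f x - 1))) :: int)"
    by (intro computable assms)
  moreover have "dec (if n \<le> m then 2 * (m - n) else Suc (2 * (n - m - 1))) = int m - int n" for m n
  proof -
    have "enc (int m - int n) = (if n \<le> m then 2 * (m - n) else Suc (2 * (n - m - 1)))"
      by (auto simp: enc_int_def int_encode_def sum_encode_def nat_diff_distrib' algebra_simps)
    then show ?thesis
      by (metis dec_enc)
  qed
  ultimately show ?thesis by simp
qed

lemma Comp_add_int [computable]: "Comp f \<Longrightarrow> Comp g \<Longrightarrow> Comp (\<lambda>x. f x + g x :: int)"
proof -
  assume "Comp f" "Comp g"
  then have "Comp (\<lambda>x. int (nat (f x) + nat (g x)) - int (nat (- f x) + nat (- g x)))"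
    by (intro Comp_diff_of_nat computable Comp_nat_minus_int)
  moreover have "int (nat i + nat j) - int (nat (- i) + nat (- j)) = i + j" for i j
    by simp
  ultimately show ?thesis by simp
qed

lemma Comp_uminus_int [computable]: "Comp f \<Longrightarrow> Comp (\<lambda>x. - f x :: int)"
proof -
  assume "Comp f"
  then have "Comp (\<lambda>x. int (nat (- f x)) - int (nat (f x)))"
    by (intro Comp_diff_of_nat computable Comp_nat_minus_int)
  moreover have "int (nat (- i)) - int (nat i) = - i" for i
    by simp
  ultimately show ?thesis by simp
qed

lemma Comp_diff_int [computable]: "Comp f \<Longrightarrow> Comp g \<Longrightarrow> Comp (\<lambda>x. f x - g x :: int)"
  using Comp_add_int[OF _ Comp_uminus_int, of f g] by simp

lemma Comp_mult_int [computable]: "Comp f \<Longrightarrow> Comp g \<Longrightarrow> Comp (\<lambda>x. f x * g x :: int)"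
proof -
  assume "Comp f" "Comp g"
  then have "Comp (\<lambda>x. int (nat (f x) * nat (g x) + nat (- f x) * nat (- g x))
       - int (nat (f x) * nat (- g x) + nat (- f x) * nat (g x)))"
    by (intro Comp_diff_of_nat computable Comp_nat_minus_int)
  moreover have "int (nat i * nat j + nat (- i) * nat (- j)) - int (nat i * nat (- j) + nat (- i) * nat j) = i * j" for i j
    by (cases "0 \<le> i"; cases "0 \<le> j") simp_all
  ultimately show ?thesis by simp
qed

lemma Dec_le_int [computable]: "Comp f \<Longrightarrow> Comp g \<Longrightarrow> Dec (\<lambda>x. (f x :: int) \<le> g x)"
proof -
  assume "Comp f" "Comp g"
  then have "Dec (\<lambda>x. nat (f x - g x) \<le> 0)"
    by (intro computable)
  then show ?thesis by simp
qed

section \<open>Products in an amalgam of two finite groups\<close>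

text \<open>Quadruples in row order: they inherit codes from the class \<open>enc\<close>, and
  finite checks on them can be done by evaluation.\<close>

type_synonym mat = "int \<times> int \<times> int \<times> int"

definition mm :: "mat \<Rightarrow> mat \<Rightarrow> mat" (infixl "\<cdot>" 70) where
  "mm = (\<lambda>(a, b, c, d) (a', b', c', d').
    (a * a' + b * c', a * b' + b * d', c * a' + d * c', c * b' + d * d'))"

definition one :: mat where "one = (1, 0, 0, 1)"

definition det2 :: "mat \<Rightarrow> int" where
  "det2 = (\<lambda>(a, b, c, d). a * d - b * c)"

text \<open>The squared Frobenius norm; leaving out the root keeps it an integer.\<close>

definition nrm :: "mat \<Rightarrow> int" where
  "nrm = (\<lambda>(a, b, c, d). a * a + b * b + c * c + d * d)"

definition adj :: "mat \<Rightarrow> mat" where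
  "adj = (\<lambda>(a, b, c, d). (d, - b, - c, a))"

definition scale :: "int \<Rightarrow> mat \<Rightarrow> mat" where
  "scale k = (\<lambda>(a, b, c, d). (k * a, k * b, k * c, k * d))"

text \<open>A determinant of 1 or -1 is its own reciprocal, so for such \<open>f\<close> this is the
  inverse matrix.\<close>

definition inverse_unit :: "mat \<Rightarrow> mat" where
  "inverse_unit f = scale (det2 f) (adj f)"

lemma mm_assoc: "a \<cdot> b \<cdot> c = a \<cdot> (b \<cdot> c)"
  by (cases a; cases b; cases c) (simp add: mm_def algebra_simps)

lemma mm_one [simp]: "one \<cdot> a = a" "a \<cdot> one = a"
  by (cases a; simp add: mm_def one_def)+

lemma det2_mm: "det2 (a \<cdot> b) = det2 a * det2 b"
  by (cases a; cases b) (simp add: mm_def det2_def algebra_simps)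

lemma det2_one [simp]: "det2 one = 1"
  by (simp add: det2_def one_def)

lemma adj_mm: "adj a \<cdot> a = scale (det2 a) one" "a \<cdot> adj a = scale (det2 a) one"
  by (cases a; simp add: adj_def mm_def scale_def one_def det2_def algebra_simps)+

lemma scale_mm: "scale k a \<cdot> b = scale k (a \<cdot> b)" "a \<cdot> scale k b = scale k (a \<cdot> b)"
  by (cases a; cases b; simp add: mm_def scale_def algebra_simps)+

lemma scale_scale: "scale k (scale l a) = scale (k * l) a"
  by (cases a) (simp add: scale_def)

lemma scale_1 [simp]: "scale 1 a = a"
  by (cases a) (simp add: scale_def)

lemma scale_inj: "k \<noteq> 0 \<Longrightarrow> scale k a = scale k b \<longleftrightarrow> a = b"
  by (cases a; cases b) (simp add: scale_def)

lemma nrm_adj: "nrm (adj a) = nrm a"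
  by (cases a) (simp add: nrm_def adj_def)

lemma nrm_scale: "nrm (scale k a) = k * k * nrm a"
  by (cases a) (simp add: nrm_def scale_def algebra_simps)

lemma nrm_nonneg: "0 \<le> nrm a"
  by (cases a) (simp add: nrm_def)

lemma inverse_unit:
  assumes "det2 f = 1 \<or> det2 f = -1"
  shows "inverse_unit f \<cdot> f = one" "f \<cdot> inverse_unit f = one"
  using assms by (auto simp: inverse_unit_def scale_mm adj_mm scale_scale)

text \<open>Cauchy-Schwarz bounds each squared entry of the product, the gap being a square by
  Lagrange's identity; the four bounds add up to the product of the norms.\<close>

lemma nrm_mm_le: "nrm (x \<cdot> y) \<le> nrm x * nrm y"
proof -
  obtain a b c d where x: "x = (a, b, c, d)" by (cases x)
  obtain a' b' c' d' where y: "y = (a', b', c', d')" by (cases y)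
  have cs: "(p * r + q * s) * (p * r + q * s) \<le> (p * p + q * q) * (r * r + s * s)" for p q r s :: int
  proof -
    have "(p * p + q * q) * (r * r + s * s) - (p * r + q * s) * (p * r + q * s) = (p * s - q * r) * (p * s - q * r)"
      by (simp add: algebra_simps)
    then show ?thesis
      using zero_le_square[of "p * s - q * r"] by linarith
  qed
  have "nrm (x \<cdot> y) \<le> (a * a + b * b) * (a' * a' + c' * c') + (a * a + b * b) * (b' * b' + d' * d')
     + (c * c + d * d) * (a' * a' + c' * c') + (c * c + d * d) * (b' * b' + d' * d')"
    unfolding nrm_def mm_def x y by (simp only: prod.case) (intro add_mono cs)
  also have "\<dots> = nrm x * nrm y"
    by (simp add: nrm_def x y algebra_simps)
  finally show ?thesis .
qed

section \<open>The two finite groups and their ping-pong sets\<close>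

text \<open>
  \<open>CC = {\<plusminus>1, \<plusminus>T}\<close> with \<open>T\<close> the coordinate swap. \<open>CC \<union> AC\<close> is the dihedral group of order 8 (the signed
  permutation matrices) and \<open>CC \<union> BC\<close> the dihedral group of order 12 generated by \<open>R\<close> and \<open>T\<close>.
\<close>

definition AC :: "mat list" where
  "AC = [(0, -1, 1, 0), (0, 1, -1, 0), (1, 0, 0, -1), (-1, 0, 0, 1)]"

definition CC :: "mat list" where
  "CC = [(1, 0, 0, 1), (-1, 0, 0, -1), (0, 1, 1, 0), (0, -1, -1, 0)]"

definition BC :: "mat list" where
  "BC = [(0, -1, 1, 1), (0, 1, -1, -1), (1, 1, -1, 0), (-1, -1, 1, 0),
         (-1, 0, 1, 1), (1, 0, -1, -1), (1, 1, 0, -1), (-1, -1, 0, 1)]"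

definition FF :: "mat list" where
  "FF = CC @ AC @ BC"

text \<open>\<open>CC @ AC\<close> and \<open>CC @ BC\<close> list groups, so a product can leave
  their union only if the factors come from different groups and neither lies in the intersection
  \<open>CC\<close>.\<close>

lemma product_in_FF:
  "\<forall>a\<in>set FF. \<forall>b\<in>set FF. a \<cdot> b \<in> set FF \<or> a \<in> set AC \<and> b \<in> set BC \<or> a \<in> set BC \<and> b \<in> set AC"
  by code_simp

text \<open>
  The two ping-pong sets: \<open>pos3\<close> contains all products of an element of \<open>AC\<close> and one of \<open>BC\<close>, in this
  order, and its image under \<open>flip\<close> those in the opposite order.
\<close>

definition pos3 :: "mat \<Rightarrow> bool" where
  "pos3 = (\<lambda>(a, b, c, d). (\<exists>s\<in>{1,-1}. s * a \<ge> 0 \<and> s * b \<ge> 0 \<and> s * c \<ge> 0 \<and> s * d \<ge> 0 \<and>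
     s * a + s * c \<ge> 1 \<and> s * b + s * d \<ge> 1 \<and> s * a + s * b + s * c + s * d \<ge> 3))"

definition flip :: "mat \<Rightarrow> mat" where
  "flip = (\<lambda>(a, b, c, d). (a, - b, - c, d))"

lemma flip_mm: "flip (a \<cdot> b) = flip a \<cdot> flip b"
  by (cases a; cases b) (simp add: flip_def mm_def)

lemma pos3_AC_BC: "\<forall>a\<in>set AC. \<forall>b\<in>set BC. pos3 (a \<cdot> b) \<and> pos3 (flip (b \<cdot> a))"
  by code_simp

lemma pos3_FF: "\<forall>f\<in>set FF. \<not> pos3 f \<and> \<not> pos3 (flip f)"
  by code_simp

text \<open>Meant for alternating words of odd length, which begin and end in the same factor. If
  such a word had its value \<open>f\<close> in \<open>FF\<close>, then cancelling the last letter
  would give an even word whose value avoids the ping-pong set it should lie in.\<close>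

lemma pos3_odd: "\<forall>f\<in>set FF. \<forall>a\<in>set AC. \<not> pos3 (f \<cdot> inverse_unit a)"
  "\<forall>f\<in>set FF. \<forall>b\<in>set BC. \<not> pos3 (flip (f \<cdot> inverse_unit b))"
  by code_simp+

text \<open>Up to a sign all entries are nonnegative. As the column sums of \<open>x\<close> are at
  least 1, each column sum of the product is at least the corresponding one of \<open>y\<close>, so
  the lower bounds on the column sums and on the total carry over from \<open>y\<close>.\<close>

lemma pos3_mm:
  assumes "pos3 x" "pos3 y"
  shows "pos3 (x \<cdot> y)"
proof -
  obtain a b c d where x: "x = (a, b, c, d)" by (cases x)
  obtain a' b' c' d' where y: "y = (a', b', c', d')" by (cases y)
  obtain s where s: "s \<in> {1,-1::int}" "s * a \<ge> 0" "s * b \<ge> 0" "s * c \<ge> 0" "s * d \<ge> 0"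
    "s * a + s * c \<ge> 1" "s * b + s * d \<ge> 1"
    using assms(1) unfolding pos3_def x prod.case by blast
  obtain t where t: "t \<in> {1,-1::int}" "t * a' \<ge> 0" "t * b' \<ge> 0" "t * c' \<ge> 0" "t * d' \<ge> 0"
    "t * a' + t * c' \<ge> 1" "t * b' + t * d' \<ge> 1" "t * a' + t * b' + t * c' + t * d' \<ge> 3"
    using assms(2) unfolding pos3_def y prod.case by blast
  define A B C D A' B' C' D' where defs: "A = s * a" "B = s * b" "C = s * c" "D = s * d"
    "A' = t * a'" "B' = t * b'" "C' = t * c'" "D' = t * d'"
  have col: "p \<le> (A + C) * p" "p \<le> (B + D) * p" if "0 \<le> p" for p
    using s that mult_right_mono[of 1 "A + C" p] mult_right_mono[of 1 "B + D" p] by (simp_all add: defs)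
  have nn: "0 \<le> A * A'" "0 \<le> A * B'" "0 \<le> C * A'" "0 \<le> C * B'" "0 \<le> B * C'" "0 \<le> B * D'" "0 \<le> D * C'" "0 \<le> D * D'"
    using s t by (simp_all add: defs)
  have eq: "s * t * (a * a' + b * c') = A * A' + B * C'" "s * t * (a * b' + b * d') = A * B' + B * D'"
    "s * t * (c * a' + d * c') = C * A' + D * C'" "s * t * (c * b' + d * d') = C * B' + D * D'"
    by (simp_all add: defs algebra_simps)
  have 1: "A' + C' \<le> (A * A' + B * C') + (C * A' + D * C')"
    "B' + D' \<le> (A * B' + B * D') + (C * B' + D * D')"
    using col(1)[of A'] col(2)[of C'] col(1)[of B'] col(2)[of D'] t by (simp_all add: defs algebra_simps)
  have "s * t \<in> {1, -1}"
    using s(1) t(1) by auto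
  then show ?thesis
    unfolding pos3_def x y mm_def prod.case
    by (intro bexI[of _ "s * t"]) (use eq 1 nn t in \<open>auto simp: defs[symmetric]\<close>)
qed

section \<open>Alternating products and the normal form theorem\<close>

definition mprod :: "mat list \<Rightarrow> mat" where
  "mprod gs = foldr (\<cdot>) gs one"

lemma mprod_simps [simp]: "mprod [] = one" "mprod (g # gs) = g \<cdot> mprod gs"
  by (simp_all add: mprod_def)

lemma mprod_append: "mprod (xs @ ys) = mprod xs \<cdot> mprod ys"
  by (induction xs) (simp_all add: mm_assoc)

definition alternate :: "mat \<Rightarrow> mat \<Rightarrow> bool" where
  "alternate a b \<longleftrightarrow> a \<in> set AC \<and> b \<in> set BC \<or> a \<in> set BC \<and> b \<in> set AC"

lemma AC_BC_disjoint: "set AC \<inter> set BC = {}"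
  by (auto simp: AC_def BC_def)

text \<open>The letters are grouped in pairs. By alternation all pairs begin in the same factor as
  the word does, so their products lie in the same ping-pong set, which is closed under
  multiplication; \<open>flip\<close> is multiplicative and handles the opposite order.\<close>

lemma pos3_even:
  assumes "successively alternate gs" "even (length gs)" "gs \<noteq> []"
  shows "(hd gs \<in> set AC \<longrightarrow> pos3 (mprod gs)) \<and> (hd gs \<in> set BC \<longrightarrow> pos3 (flip (mprod gs)))"
  using assms
proof (induction gs rule: induct_list012)
  case (3 a b gs)
  have ab: "alternate a b" "successively alternate gs"
    using 3(3) by (auto simp: successively_Cons)
  have 0: "(a \<in> set AC \<longrightarrow> pos3 (a \<cdot> b)) \<and> (a \<in> set BC \<longrightarrow> pos3 (flip (a \<cdot> b)))"
    using ab(1) AC_BC_disjoint pos3_AC_BC unfolding alternate_def by blast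
  show ?case
  proof (cases "gs = []")
    case True
    with 0 show ?thesis by simp
  next
    case False
    then have "alternate b (hd gs)"
      using 3(3) by (auto simp: successively_Cons)
    moreover have "(hd gs \<in> set AC \<longrightarrow> pos3 (mprod gs)) \<and> (hd gs \<in> set BC \<longrightarrow> pos3 (flip (mprod gs)))"
      using 3(1) ab(2) 3(4) False by simp
    moreover have "mprod (a # b # gs) = a \<cdot> b \<cdot> mprod gs"
      by (simp add: mm_assoc)
    moreover from this have "flip (mprod (a # b # gs)) = flip (a \<cdot> b) \<cdot> flip (mprod gs)"
      by (simp add: flip_mm)
    ultimately show ?thesis
      using 0 ab(1) AC_BC_disjoint unfolding alternate_def list.sel by (auto simp del: mprod_simps intro!: pos3_mm)
  qed
qed auto

lemma FF_unit: "f \<in> set FF \<Longrightarrow> det2 f = 1 \<or> det2 f = -1"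
  by (auto simp: FF_def AC_def BC_def CC_def det2_def)

lemma alternate_FF: "alternate a b \<Longrightarrow> a \<in> set FF \<and> b \<in> set FF"
  by (auto simp: alternate_def FF_def)

text \<open>This is the normal form theorem in the form used here. Words of even length land in a
  ping-pong set, which is disjoint from \<open>FF\<close>; words of odd length become even by
  cancelling the last letter.\<close>

lemma alternating_not_FF:
  assumes alternate: "successively alternate gs" and len: "length gs \<ge> 2"
  shows "mprod gs \<notin> set FF"
proof
  assume f: "mprod gs \<in> set FF"
  have hd: "hd gs \<in> set AC \<or> hd gs \<in> set BC"
    using alternate len by (cases gs rule: remdups_adj.cases) (auto simp: alternate_def)
  show False
  proof (cases "even (length gs)")
    case True
    then show False
      using pos3_even[OF alternate] hd f pos3_FF len by fastforce
  next
    case False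
    then obtain xs y where gs: "gs = xs @ [y]"
      by (cases gs rule: rev_cases) auto
    have xs: "successively alternate xs" "even (length xs)" "xs \<noteq> []"
      using False alternate len by (auto simp: gs successively_append_iff)
    have bly: "alternate (last xs) y"
      using alternate xs by (auto simp: gs successively_append_iff dest: alternate_FF)
    then have y: "y \<in> set FF"
      by (auto dest: alternate_FF)
    have eq: "mprod gs \<cdot> inverse_unit y = mprod xs"
      using inverse_unit(2)[OF FF_unit[OF y]] by (simp add: gs mprod_append mm_assoc)
    \<comment> \<open>The first letter and the letter after an even-length word are an even number
      of alternations apart, hence in the same factor.\<close>
    have same: "hd xs \<in> set AC \<longleftrightarrow> y \<in> set AC" if "successively alternate (xs @ [y])" "even (length xs)" "xs \<noteq> []" for xs y
      using that
    proof (induction xs rule: induct_list012)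
      case (3 a b xs)
      show ?case
      proof (cases "xs = []")
        case True
        with 3 AC_BC_disjoint show ?thesis
          unfolding alternate_def by (auto simp: successively_Cons alternate_def)
      next
        case False
        with 3 have "hd xs \<in> set AC \<longleftrightarrow> y \<in> set AC" "alternate a b" "alternate b (hd xs)"
          by (auto simp: successively_Cons)
        with AC_BC_disjoint show ?thesis
          unfolding alternate_def by auto
      qed
    qed auto
    have "hd xs = hd gs"
      using xs(3) by (simp add: gs)
    moreover have "y \<in> set AC \<or> y \<in> set BC"
      using bly by (auto simp: alternate_def)
    ultimately show False
      using same[OF alternate[unfolded gs] xs(2,3)] pos3_even[OF xs] pos3_odd f hd eq by metis
  qed
qed

lemma not_successively_split:
  "\<not> successively P xs \<Longrightarrow> \<exists>us a b vs. xs = us @ [a, b] @ vs \<and> \<not> P a b"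
proof (induction xs rule: induct_list012)
  case (3 a b xs)
  show ?case
  proof (cases "P a b")
    case False
    then show ?thesis
      by (intro exI[of _ "[]"] exI[of _ a] exI[of _ b] exI[of _ xs]) simp
  next
    case True
    with 3 obtain us c d vs where "b # xs = us @ [c, d] @ vs" "\<not> P c d"
      by auto
    then show ?thesis
      by (intro exI[of _ "a # us"] exI[of _ c] exI[of _ d] exI[of _ vs]) simp
  qed
qed auto

text \<open>By the normal form theorem the word cannot alternate, and by
  \<open>product_in_FF\<close> a pair of neighbours that violates alternation has its product in
  \<open>FF\<close>.\<close>

lemma adjacent_product_in_FF:
  assumes "set gs \<subseteq> set FF" "length gs \<ge> 2" "mprod gs \<in> set FF"
  obtains us a b vs where "gs = us @ [a, b] @ vs" "a \<cdot> b \<in> set FF"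
proof -
  have "\<not> successively alternate gs"
    using alternating_not_FF assms(2,3) by blast
  then obtain us a b vs where gs: "gs = us @ [a, b] @ vs" "\<not> alternate a b"
    using not_successively_split by blast
  moreover have "a \<cdot> b \<in> set FF"
    using product_in_FF gs assms(1) unfolding alternate_def by auto
  ultimately show thesis using that by blast
qed

section \<open>Paths in graphs labelled with nonsingular matrices\<close>

inductive path :: "('s \<times> mat \<times> 's) set \<Rightarrow> 's \<Rightarrow> mat \<Rightarrow> 's \<Rightarrow> bool" for E where
  path_Nil: "path E s one s"
| path_Cons: "(s, g, r) \<in> E \<Longrightarrow> path E r h q \<Longrightarrow> path E s (g \<cdot> h) q"

lemma path_edge: "(s, g, r) \<in> E \<Longrightarrow> path E s g r"
  using path_Cons[OF _ path_Nil, of s g r E] by simp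

lemma path_trans: "path E s g r \<Longrightarrow> path E r h q \<Longrightarrow> path E s (g \<cdot> h) q"
  by (induction rule: path.induct) (auto simp: mm_assoc intro: path_Cons)

lemma path_mono: "path E s g q \<Longrightarrow> E \<subseteq> E' \<Longrightarrow> path E' s g q"
  by (induction rule: path.induct) (auto intro: path.intros)

section \<open>Gauss reduction of the columns\<close>

definition reduced :: "mat \<Rightarrow> bool" where
  "reduced = (\<lambda>(a, b, c, d). 2 * \<bar>a * b + c * d\<bar> \<le> a * a + c * c \<and> 2 * \<bar>a * b + c * d\<bar> \<le> b * b + d * d)"

text \<open>Let \<open>u\<close>, \<open>v\<close> be the squared lengths of the columns and
  \<open>w\<close> their inner product. Reducedness gives \<open>4 * w * w \<le> u * v\<close>, and
  the Gram determinant gives \<open>u * v = det * det + w * w\<close>; together these bound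
  \<open>u * v\<close>.\<close>

lemma reduced_columns:
  assumes "reduced (a, b, c, d)" "det2 (a, b, c, d) \<noteq> 0"
  shows "1 \<le> a * a + c * c" "1 \<le> b * b + d * d"
    "3 * ((a * a + c * c) * (b * b + d * d)) \<le> 4 * (det2 (a, b, c, d) * det2 (a, b, c, d))"
proof -
  let ?u = "a * a + c * c" and ?v = "b * b + d * d" and ?w = "a * b + c * d"
  have "a \<noteq> 0 \<or> c \<noteq> 0" "b \<noteq> 0 \<or> d \<noteq> 0"
    using assms(2) by (auto simp: det2_def)
  then have "0 < ?u" "0 < ?v"
    using sum_squares_gt_zero_iff[of a c] sum_squares_gt_zero_iff[of b d] by auto
  then show "1 \<le> ?u" "1 \<le> ?v"
    by simp_all
  have "(2 * \<bar>?w\<bar>) * (2 * \<bar>?w\<bar>) \<le> ?u * ?v"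
    using assms(1) by (intro mult_mono) (auto simp: reduced_def)
  moreover have "(2 * \<bar>?w\<bar>) * (2 * \<bar>?w\<bar>) = 4 * (?w * ?w)"
    by simp
  moreover have "?u * ?v = det2 (a, b, c, d) * det2 (a, b, c, d) + ?w * ?w"
    by (simp add: det2_def algebra_simps)
  ultimately show "3 * (?u * ?v) \<le> 4 * (det2 (a, b, c, d) * det2 (a, b, c, d))"
    by linarith
qed

text \<open>For \<open>u\<close>, \<open>v\<close> at least 1,
  \<open>(u - 1) * (v - 1) \<ge> 0\<close> bounds the sum \<open>u + v\<close> by
  \<open>1 + u * v\<close>. The factor 2 rounds up the 4/3 from
  \<open>reduced_columns\<close>.\<close>

lemma nrm_reduced:
  assumes "reduced K" "det2 K \<noteq> 0"
  shows "nrm K \<le> 1 + 2 * (det2 K * det2 K)"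
proof -
  obtain a b c d where K: "K = (a, b, c, d)" by (cases K)
  have "0 \<le> (a * a + c * c - 1) * (b * b + d * d - 1)"
    using reduced_columns(1,2)[OF assms[unfolded K]] by simp
  then have "a * a + c * c + (b * b + d * d) \<le> 1 + (a * a + c * c) * (b * b + d * d)"
    by (simp add: algebra_simps)
  with reduced_columns(3)[OF assms[unfolded K]] have "a * a + c * c + (b * b + d * d) \<le> 1 + 2 * (det2 K * det2 K)"
    using zero_le_square[of "det2 K"] unfolding K by linarith
  then show ?thesis
    by (simp add: nrm_def K)
qed

lemma square_le_oneD: "x * x \<le> 1 \<Longrightarrow> x \<in> {-1, 0, 1}" for x :: int
  by (cases "x \<ge> 2"; cases "x \<le> -2")
    (use mult_mono[of 2 x 2 x] mult_mono[of 2 "- x" 2 "- x"] in auto)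

text \<open>The squared column lengths have a product of at most 4/3, so both are 1 and only the
  signed permutation matrices remain; these are listed in \<open>CC\<close> and
  \<open>AC\<close>.\<close>

lemma reduced_unit:
  assumes "reduced K" "det2 K = 1 \<or> det2 K = -1"
  shows "K \<in> set FF"
proof -
  obtain a b c d where K: "K = (a, b, c, d)" by (cases K)
  let ?u = "a * a + c * c" and ?v = "b * b + d * d"
  have det: "det2 K * det2 K = 1" "det2 K \<noteq> 0"
    using assms(2) by auto
  note r = reduced_columns[OF assms(1)[unfolded K] det(2)[unfolded K]]
  have "?u * ?v \<le> 1"
    using r(3) det(1) by (simp add: K)
  moreover have "?u * 1 \<le> ?u * ?v" "1 * ?v \<le> ?u * ?v"
    using r(1,2) by (intro mult_left_mono mult_right_mono; simp)+
  ultimately have uv: "?u \<le> 1" "?v \<le> 1"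
    by simp_all
  have "a * a \<le> 1" "b * b \<le> 1" "c * c \<le> 1" "d * d \<le> 1"
    using uv zero_le_square[of a] zero_le_square[of b] zero_le_square[of c] zero_le_square[of d]
    by linarith+
  then have "a \<in> {-1, 0, 1}" "b \<in> {-1, 0, 1}" "c \<in> {-1, 0, 1}" "d \<in> {-1, 0, 1}"
    by (simp_all only: square_le_oneD)
  moreover have "\<forall>a\<in>{-1, 0, 1}. \<forall>b\<in>{-1, 0, 1}. \<forall>c\<in>{-1, 0, 1}. \<forall>d\<in>{-1, 0, 1}.
    a * a + c * c \<le> 1 \<longrightarrow> b * b + d * d \<le> 1 \<longrightarrow> det2 (a, b, c, d) \<noteq> 0 \<longrightarrow> (a, b, c, d) \<in> set FF"
    by code_simp
  ultimately show ?thesis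
    using uv det(2) unfolding K by blast
qed

text \<open>
  One step of Gauss lattice reduction on the columns. \<open>FF\<close> only offers subtraction of one column from
  the other, so \<open>f\<close> first makes the inner product of the columns nonnegative.
\<close>

lemma reduction_step:
  assumes "\<not> reduced K"
  obtains f g where "f \<in> set FF" "g \<in> set FF" "nrm (K \<cdot> f) = nrm K" "nrm (K \<cdot> f \<cdot> g) < nrm K"
proof -
  obtain a b c d where K: "K = (a, b, c, d)" by (cases K)
  define f :: mat where "f = (if a * b + c * d \<ge> 0 then (1, 0, 0, 1) else (1, 0, 0, -1))"
  \<comment> \<open>\<open>g\<close> replaces one column by its difference from the other. The norm
    changes by the squared length of the column that is kept minus twice the inner product, which is
    negative by the violated inequality.\<close>
  define g :: mat where "g = (if 2 * \<bar>a * b + c * d\<bar> > a * a + c * c then (1, 1, 0, -1) else (-1, 0, 1, 1))"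
  have "f \<in> set FF" "g \<in> set FF"
    by (auto simp: f_def g_def FF_def AC_def BC_def CC_def)
  moreover have "nrm (K \<cdot> f) = nrm K"
    by (simp add: f_def nrm_def K mm_def)
  moreover have "nrm (K \<cdot> f \<cdot> g) < nrm K"
    using assms by (auto simp: f_def g_def nrm_def K mm_def reduced_def algebra_simps)
  ultimately show thesis
    using that by blast
qed

section \<open>Walks with labels in the finite set and their collapse\<close>

fun walk :: "('u \<times> mat \<times> 'u) set \<Rightarrow> 'u \<Rightarrow> mat list \<Rightarrow> 'u \<Rightarrow> bool" where
  "walk \<Omega> u [] v \<longleftrightarrow> u = v"
| "walk \<Omega> u (f # fs) v \<longleftrightarrow> f \<in> set FF \<and> (\<exists>w. (u, f, w) \<in> \<Omega> \<and> walk \<Omega> w fs v)"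

lemma walk_append: "walk \<Omega> u (fs @ gs) v \<longleftrightarrow> (\<exists>w. walk \<Omega> u fs w \<and> walk \<Omega> w gs v)"
  by (induction fs arbitrary: u) auto

lemma walk_appendI: "walk \<Omega> u fs w \<Longrightarrow> walk \<Omega> w gs v \<Longrightarrow> walk \<Omega> u (fs @ gs) v"
  by (auto simp only: walk_append)

lemma walk_ConsI: "(u, f, w) \<in> \<Omega> \<Longrightarrow> f \<in> set FF \<Longrightarrow> walk \<Omega> w fs v \<Longrightarrow> walk \<Omega> u (f # fs) v"
  by (auto simp only: walk.simps)

lemma walk_FF: "walk \<Omega> u fs v \<Longrightarrow> set fs \<subseteq> set FF"
  by (induction fs arbitrary: u) auto

lemma det2_mprod: "set fs \<subseteq> set FF \<Longrightarrow> det2 (mprod fs) = 1 \<or> det2 (mprod fs) = -1"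
proof (induction fs)
  case (Cons f fs)
  then have "det2 f = 1 \<or> det2 f = -1" "det2 (mprod fs) = 1 \<or> det2 (mprod fs) = -1"
    using FF_unit[of f] by auto
  then show ?case by (auto simp: det2_mm)
qed simp

lemma one_FF: "one \<in> set FF"
  by (simp add: FF_def CC_def one_def)

lemma inverse_unit_FF: "\<forall>f\<in>set FF. inverse_unit f \<in> set FF"
  by code_simp

text \<open>Projections and quantifiers bounded by \<open>\<Omega>\<close> make this decidable when
  \<open>\<Omega>\<close> is given as a list.\<close>

definition composition_closed :: "('u \<times> mat \<times> 'u) set \<Rightarrow> bool" where
  "composition_closed \<Omega> \<longleftrightarrow>
    (\<forall>x\<in>\<Omega>. \<forall>y\<in>\<Omega>. snd (snd x) = fst y \<longrightarrow> fst (snd x) \<cdot> fst (snd y) \<in> set FF \<longrightarrow>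
      (fst x, fst (snd x) \<cdot> fst (snd y), snd (snd y)) \<in> \<Omega>)"

lemma composition_closedD:
  "composition_closed \<Omega> \<Longrightarrow> (u, f, v) \<in> \<Omega> \<Longrightarrow> (v, g, w) \<in> \<Omega> \<Longrightarrow> f \<cdot> g \<in> set FF \<Longrightarrow> (u, f \<cdot> g, w) \<in> \<Omega>"
  unfolding composition_closed_def by fastforce

text \<open>Induction on the length: while at least two labels remain,
  \<open>adjacent_product_in_FF\<close> finds neighbours whose product stays in \<open>FF\<close>,
  and closure merges their two steps into one.\<close>

lemma walk_collapse:
  assumes "composition_closed \<Omega>"
  shows "walk \<Omega> u fs v \<Longrightarrow> fs \<noteq> [] \<Longrightarrow> mprod fs \<in> set FF \<Longrightarrow> (u, mprod fs, v) \<in> \<Omega>"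
proof (induction fs rule: length_induct)
  case (1 fs)
  show ?case
  proof (cases "length fs = 1")
    case True
    with 1 show ?thesis
      by (cases fs) auto
  next
    case False
    with 1(3) have "length fs \<ge> 2"
      by (cases fs rule: remdups_adj.cases) auto
    then obtain us a b vs where fs: "fs = us @ [a, b] @ vs" and ab: "a \<cdot> b \<in> set FF"
      using adjacent_product_in_FF[OF walk_FF[OF 1(2)]] 1(4) by metis
    have "walk \<Omega> u (us @ [a \<cdot> b] @ vs) v"
      using 1(2) ab composition_closedD[OF assms] unfolding fs walk_append append_Cons append_Nil walk.simps
      by blast
    moreover have eq: "mprod (us @ [a \<cdot> b] @ vs) = mprod fs"
      by (simp add: fs mprod_append mm_assoc)
    moreover have "length (us @ [a \<cdot> b] @ vs) < length fs" "us @ [a \<cdot> b] @ vs \<noteq> []"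
      by (simp_all add: fs)
    ultimately show ?thesis
      using 1(1,4) by metis
  qed
qed

section \<open>Saturated families as certificates\<close>

text \<open>
  A triple \<open>((p, K), f, (q, K'))\<close> stands for: some path from \<open>p\<close> to \<open>q\<close> has a product \<open>g\<close> with
  \<open>g \<cdot> K' = K \<cdot> f\<close>.
\<close>

definition saturated :: "('s \<times> mat \<times> 's) set \<Rightarrow> 's set \<Rightarrow> int \<Rightarrow> (('s \<times> mat) \<times> mat \<times> ('s \<times> mat)) set \<Rightarrow> bool" where
  "saturated E S D \<Omega> \<longleftrightarrow>
    (\<forall>p\<in>S. \<forall>f\<in>set FF. \<forall>K. nrm K \<le> D \<longrightarrow> nrm (K \<cdot> f) \<le> D \<longrightarrow> ((p, K), f, (p, K \<cdot> f)) \<in> \<Omega>) \<and>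
    (\<forall>e\<in>E. \<forall>K. nrm K \<le> D \<longrightarrow> nrm (fst (snd e) \<cdot> K) \<le> D \<longrightarrow>
      ((fst e, fst (snd e) \<cdot> K), one, (snd (snd e), K)) \<in> \<Omega>) \<and>
    composition_closed \<Omega>"

lemma saturated_unit:
  "saturated E S D \<Omega> \<Longrightarrow> p \<in> S \<Longrightarrow> f \<in> set FF \<Longrightarrow> nrm K \<le> D \<Longrightarrow> nrm (K \<cdot> f) \<le> D \<Longrightarrow>
    ((p, K), f, (p, K \<cdot> f)) \<in> \<Omega>"
  unfolding saturated_def by blast

lemma saturated_edge:
  "saturated E S D \<Omega> \<Longrightarrow> (p, g, q) \<in> E \<Longrightarrow> nrm K \<le> D \<Longrightarrow> nrm (g \<cdot> K) \<le> D \<Longrightarrow>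
    ((p, g \<cdot> K), one, (q, K)) \<in> \<Omega>"
  unfolding saturated_def by (metis fst_conv snd_conv)

text \<open>The number \<open>1 + 2 * (det2 T * det2 T)\<close> bounds the norm of a nonsingular
  reduced matrix whose determinant is at most that of \<open>T\<close> in absolute value
  (\<open>nrm_reduced\<close>). Multiplied by the norm of an edge label, it bounds what is left
  after cancelling that label (\<open>nrm_right_factor_le\<close>).\<close>

definition large_enough :: "('s \<times> mat \<times> 's) set \<Rightarrow> mat \<Rightarrow> int \<Rightarrow> bool" where
  "large_enough E T D \<longleftrightarrow> nrm T \<le> D \<and> 1 + 2 * (det2 T * det2 T) \<le> D \<and>
    (\<forall>e\<in>E. nrm (fst (snd e)) * (1 + 2 * (det2 T * det2 T)) \<le> D)"

text \<open>Reduction steps never increase the norm, not even halfway, so the whole reduction stays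
  within norm \<open>D\<close>, where saturation provides the triples. Since the norm drops, it
  terminates.\<close>

lemma reduce_walk:
  assumes sat: "saturated E S D \<Omega>" and p: "p \<in> S"
  shows "nrm K \<le> D \<Longrightarrow> \<exists>fs. walk \<Omega> (p, K) fs (p, K \<cdot> mprod fs) \<and> reduced (K \<cdot> mprod fs)"
proof (induction "nat (nrm K)" arbitrary: K rule: less_induct)
  case less
  show ?case
  proof (cases "reduced K")
    case True
    then show ?thesis
      by (intro exI[of _ "[]"]) simp
  next
    case False
    then obtain f g where fg: "f \<in> set FF" "g \<in> set FF" "nrm (K \<cdot> f) = nrm K" "nrm (K \<cdot> f \<cdot> g) < nrm K"
      by (rule reduction_step)
    have "nat (nrm (K \<cdot> f \<cdot> g)) < nat (nrm K)"
      using fg(4) nrm_nonneg[of "K \<cdot> f \<cdot> g"] by linarith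
    then obtain fs where fs: "walk \<Omega> (p, K \<cdot> f \<cdot> g) fs (p, K \<cdot> f \<cdot> g \<cdot> mprod fs)"
      "reduced (K \<cdot> f \<cdot> g \<cdot> mprod fs)"
      using less(1)[of "K \<cdot> f \<cdot> g"] fg(4) less(2) by auto
    have "((p, K), f, (p, K \<cdot> f)) \<in> \<Omega>" "((p, K \<cdot> f), g, (p, K \<cdot> f \<cdot> g)) \<in> \<Omega>"
      using saturated_unit[OF sat p] fg less(2) by auto
    moreover have "K \<cdot> mprod (f # g # fs) = K \<cdot> f \<cdot> g \<cdot> mprod fs"
      by (simp add: mm_assoc)
    ultimately show ?thesis
      using fs fg(1,2) by (metis walk.simps(2))
  qed
qed

text \<open>Multiplying \<open>g \<cdot> K\<close> by the adjugate of \<open>g\<close>, which has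
  the same norm as \<open>g\<close>, recovers \<open>K\<close> up to the factor
  \<open>det2 g\<close>, whose square is at least 1.\<close>

lemma nrm_right_factor_le:
  assumes "det2 g \<noteq> 0"
  shows "nrm K \<le> nrm g * nrm (g \<cdot> K)"
proof -
  have "adj g \<cdot> (g \<cdot> K) = scale (det2 g) K"
    by (simp add: adj_mm scale_mm flip: mm_assoc)
  then have "det2 g * det2 g * nrm K \<le> nrm g * nrm (g \<cdot> K)"
    using nrm_mm_le[of "adj g" "g \<cdot> K"] by (simp add: nrm_scale nrm_adj)
  moreover have "1 \<le> det2 g * det2 g"
    using assms by (metis int_one_le_iff_zero_less mult_eq_0_iff not_square_less_zero linorder_less_linear)
  then have "1 * nrm K \<le> det2 g * det2 g * nrm K"
    using nrm_nonneg by (intro mult_right_mono)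
  ultimately show ?thesis by simp
qed

lemma square_le_mult_square:
  fixes g k :: int
  assumes "g \<noteq> 0"
  shows "k * k \<le> (g * k) * (g * k)"
proof -
  have "1 \<le> g * g"
    using assms by (metis int_one_le_iff_zero_less mult_eq_0_iff not_square_less_zero linorder_less_linear)
  then have "1 * (k * k) \<le> (g * g) * (k * k)"
    by (intro mult_right_mono) simp_all
  then show ?thesis by (simp add: algebra_simps)
qed

text \<open>Induction along the path, with \<open>H\<close> the reduced form of what remains to be
  traversed. Crossing an edge cancels its label on the left of \<open>H\<close>; the result is
  reduced again, and the unit used for this is absorbed into \<open>K\<close>. Determinants can only
  shrink in absolute value, so the norm bounds of \<open>large_enough\<close> hold at every
  edge.\<close>

lemma simulate_path:
  assumes sat: "saturated E S D \<Omega>" and large: "large_enough E T D"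
    and E: "\<And>s g q. (s, g, q) \<in> E \<Longrightarrow> det2 g \<noteq> 0 \<and> q \<in> S"
  shows "path E s g q \<Longrightarrow> s \<in> S \<Longrightarrow> g \<cdot> K = H \<Longrightarrow> reduced H \<Longrightarrow> det2 H \<noteq> 0 \<Longrightarrow>
    det2 H * det2 H \<le> det2 T * det2 T \<Longrightarrow>
    q \<in> S \<and> (\<exists>fs. walk \<Omega> (s, H) fs (q, K \<cdot> mprod fs) \<and> reduced (K \<cdot> mprod fs))"
proof (induction arbitrary: K H rule: path.induct)
  case (path_Nil s)
  then show ?case
    by (auto intro!: exI[of _ "[]"])
next
  case (path_Cons s g r h q)
  define m where "m = det2 T * det2 T"
  define K1 where "K1 = h \<cdot> K"
  have gK1: "g \<cdot> K1 = H"
    using path_Cons.prems(2) by (simp add: K1_def mm_assoc)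
  have g: "det2 g \<noteq> 0" and r: "r \<in> S"
    using E[OF path_Cons.hyps(1)] by auto
  have H: "nrm H \<le> 1 + 2 * m"
    using nrm_reduced[OF path_Cons.prems(3,4)] path_Cons.prems(5) by (simp add: m_def)
  then have HD: "nrm H \<le> D"
    using large by (simp add: large_enough_def m_def)
  have "nrm K1 \<le> nrm g * nrm H"
    using nrm_right_factor_le[OF g, of K1] by (simp add: gK1)
  also have "\<dots> \<le> nrm g * (1 + 2 * m)"
    by (intro mult_left_mono H nrm_nonneg)
  also have "\<dots> \<le> D"
    using large path_Cons.hyps(1) by (force simp: large_enough_def m_def)
  finally have K1D: "nrm K1 \<le> D" .
  have edge: "((s, H), one, (r, K1)) \<in> \<Omega>"
    using saturated_edge[OF sat path_Cons.hyps(1) K1D] HD gK1 by simp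
  obtain fs where fs: "walk \<Omega> (r, K1) fs (r, K1 \<cdot> mprod fs)" "reduced (K1 \<cdot> mprod fs)"
    using reduce_walk[OF sat r K1D] by blast
  have detH: "det2 H = det2 g * det2 K1"
    by (simp flip: gK1 add: det2_mm)
  have unit: "det2 (mprod fs) = 1 \<or> det2 (mprod fs) = -1"
    using det2_mprod[OF walk_FF[OF fs(1)]] .
  then have det1: "det2 (K1 \<cdot> mprod fs) * det2 (K1 \<cdot> mprod fs) = det2 K1 * det2 K1"
    by (auto simp: det2_mm)
  have "q \<in> S \<and> (\<exists>gs. walk \<Omega> (r, K1 \<cdot> mprod fs) gs (q, (K \<cdot> mprod fs) \<cdot> mprod gs) \<and>
    reduced ((K \<cdot> mprod fs) \<cdot> mprod gs))"
  proof (rule path_Cons.IH[OF r _ fs(2)])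
    show "h \<cdot> (K \<cdot> mprod fs) = K1 \<cdot> mprod fs"
      by (simp add: K1_def mm_assoc)
    show "det2 (K1 \<cdot> mprod fs) \<noteq> 0"
      using path_Cons.prems(4) unit detH by (auto simp: det2_mm)
    show "det2 (K1 \<cdot> mprod fs) * det2 (K1 \<cdot> mprod fs) \<le> det2 T * det2 T"
      using square_le_mult_square[OF g, of "det2 K1"] path_Cons.prems(5) detH det1 by simp
  qed
  then obtain gs where gs: "q \<in> S" "walk \<Omega> (r, K1 \<cdot> mprod fs) gs (q, K \<cdot> mprod fs \<cdot> mprod gs)"
    "reduced (K \<cdot> mprod fs \<cdot> mprod gs)" by blast
  have "walk \<Omega> (s, H) (one # fs @ gs) (q, K \<cdot> mprod (one # fs @ gs))"
    using walk_ConsI[OF edge one_FF walk_appendI[OF fs(1) gs(2)]] by (simp add: mprod_append mm_assoc)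
  then show ?case
    using gs(1,3) by (intro conjI exI[of _ "one # fs @ gs"]) (simp_all add: mprod_append mm_assoc)
qed

text \<open>First \<open>T\<close> is reduced by labels \<open>fs\<close>, then the path is followed
  with \<open>K = mprod fs\<close>. The matrix reached at \<open>q\<close> is therefore the product
  \<open>H\<close> of all labels so far, a reduced unit and hence in \<open>FF\<close>. One more
  step by its inverse ends at \<open>one\<close>, and the complete label product is
  \<open>one\<close>, so the walk collapses to a single triple.\<close>

lemma saturated_contains_path:
  assumes sat: "saturated E S D \<Omega>" and large: "large_enough E T D"
    and E: "\<And>s g q. (s, g, q) \<in> E \<Longrightarrow> det2 g \<noteq> 0 \<and> q \<in> S"
    and path: "path E s T q" and s: "s \<in> S" and T: "det2 T \<noteq> 0"
  shows "((s, T), one, (q, one)) \<in> \<Omega>"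
proof -
  have TD: "nrm T \<le> D" and D: "1 + 2 * (det2 T * det2 T) \<le> D"
    using large by (auto simp: large_enough_def)
  obtain fs where fs: "walk \<Omega> (s, T) fs (s, T \<cdot> mprod fs)" "reduced (T \<cdot> mprod fs)"
    using reduce_walk[OF sat s TD] by blast
  have unit: "det2 (mprod fs) = 1 \<or> det2 (mprod fs) = -1"
    using det2_mprod[OF walk_FF[OF fs(1)]] .
  have "q \<in> S \<and> (\<exists>gs. walk \<Omega> (s, T \<cdot> mprod fs) gs (q, mprod fs \<cdot> mprod gs) \<and>
    reduced (mprod fs \<cdot> mprod gs))"
    by (rule simulate_path[OF sat large _ path s refl fs(2)])
      (use E unit T in \<open>auto simp: det2_mm\<close>)
  then obtain gs where q: "q \<in> S" and gs: "walk \<Omega> (s, T \<cdot> mprod fs) gs (q, mprod fs \<cdot> mprod gs)"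
    "reduced (mprod fs \<cdot> mprod gs)"
    by blast
  define H where "H = mprod fs \<cdot> mprod gs"
  have unitH: "det2 H = 1 \<or> det2 H = -1"
    using unit det2_mprod[OF walk_FF[OF gs(1)]] by (auto simp: H_def det2_mm)
  then have HFF: "H \<in> set FF" and HD: "nrm H \<le> D"
    using reduced_unit[OF gs(2)] nrm_reduced[OF gs(2)] D square_le_mult_square[OF T, of 1]
    by (auto simp: H_def)
  \<comment> \<open>\<open>one\<close> has norm 2, and \<open>D\<close> is at least 3 because
    \<open>det2 T\<close> is nonzero.\<close>
  have "nrm (H \<cdot> inverse_unit H) \<le> D"
    using square_le_mult_square[OF T, of 1] D
    by (simp add: inverse_unit[OF unitH]) (simp add: nrm_def one_def)
  then have "((q, H), inverse_unit H, (q, one)) \<in> \<Omega>"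
    using saturated_unit[OF sat q, of "inverse_unit H" H] HFF HD inverse_unit_FF
    by (simp add: inverse_unit[OF unitH])
  then have walk: "walk \<Omega> (s, T) (fs @ gs @ [inverse_unit H]) (q, one)"
    using HFF inverse_unit_FF gs(1)
    by (intro walk_appendI[OF fs(1)] walk_appendI[of _ _ gs "(q, H)"] walk_ConsI[of _ _ "(q, one)"]) (auto simp: H_def)
  have "mprod (fs @ gs @ [inverse_unit H]) = H \<cdot> inverse_unit H"
    by (simp add: mprod_append H_def mm_assoc)
  then have "mprod (fs @ gs @ [inverse_unit H]) = one"
    by (simp add: inverse_unit[OF unitH])
  with walk_collapse[OF _ walk] sat show ?thesis
    by (simp add: saturated_def one_FF)
qed

lemma abs_le_nrm: "nrm (a, b, c, d) \<le> D \<Longrightarrow> \<bar>a\<bar> \<le> D \<and> \<bar>b\<bar> \<le> D \<and> \<bar>c\<bar> \<le> D \<and> \<bar>d\<bar> \<le> D"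
proof -
  have "\<bar>x\<bar> \<le> x * x" for x :: int
  proof -
    have "0 \<le> \<bar>x\<bar> * (\<bar>x\<bar> - 1)"
      by (cases "x = 0") auto
    then show ?thesis
      by (simp add: algebra_simps)
  qed
  from this[of a] this[of b] this[of c] this[of d] show "nrm (a, b, c, d) \<le> D \<Longrightarrow> ?thesis"
    unfolding nrm_def prod.case by linarith
qed

lemma finite_nrm: "finite {K. nrm K \<le> D}"
proof (rule finite_subset)
  show "{K. nrm K \<le> D} \<subseteq> {-D..D} \<times> {-D..D} \<times> {-D..D} \<times> {-D..D}"
    using abs_le_nrm by fastforce
qed simp

text \<open>All triples within norm \<open>D\<close> that are true in their intended meaning form
  such a family: truth is preserved by composition, and a norm bound leaves finitely many matrices.
  With label \<open>one\<close> and final matrix \<open>one\<close>, truth says that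
  \<open>K\<close> itself is the product of a path.\<close>

lemma saturated_exists:
  assumes "finite S" and E: "\<And>s g q. (s, g, q) \<in> E \<Longrightarrow> s \<in> S \<and> q \<in> S"
  obtains \<Omega> where "saturated E S D \<Omega>" "finite \<Omega>"
    "\<And>s q K. ((s, K), one, (q, one)) \<in> \<Omega> \<Longrightarrow> path E s K q"
proof -
  define \<Omega> where "\<Omega> = {x \<in> (S \<times> {K. nrm K \<le> D}) \<times> set FF \<times> (S \<times> {K. nrm K \<le> D}).
    \<exists>g. path E (fst (fst x)) g (fst (snd (snd x))) \<and>
      g \<cdot> snd (snd (snd x)) = snd (fst x) \<cdot> fst (snd x)}"
  have \<Omega>: "((p, K), f, (q, K')) \<in> \<Omega> \<longleftrightarrow> p \<in> S \<and> q \<in> S \<and> nrm K \<le> D \<and> nrm K' \<le> D \<and> f \<in> set FF \<and>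
    (\<exists>g. path E p g q \<and> g \<cdot> K' = K \<cdot> f)" for p K f q K'
    by (auto simp: \<Omega>_def)
  have "composition_closed \<Omega>"
    unfolding composition_closed_def
  proof (intro ballI impI)
    fix x y
    assume *: "x \<in> \<Omega>" "y \<in> \<Omega>" "snd (snd x) = fst y" "fst (snd x) \<cdot> fst (snd y) \<in> set FF"
    obtain p K f q K' where x: "x = ((p, K), f, (q, K'))"
      by (metis surj_pair)
    obtain f' r K'' where y: "y = ((q, K'), f', (r, K''))"
      using *(3) x by (metis surj_pair fst_conv snd_conv)
    from * obtain g h where g: "path E p g q" "g \<cdot> K' = K \<cdot> f" and h: "path E q h r" "h \<cdot> K'' = K' \<cdot> f'"
      by (auto simp: x y \<Omega>)
    have "g \<cdot> h \<cdot> K'' = K \<cdot> (f \<cdot> f')"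
      using g(2) h(2) by (metis mm_assoc)
    then have "\<exists>g. path E p g r \<and> g \<cdot> K'' = K \<cdot> (f \<cdot> f')"
      using path_trans[OF g(1) h(1)] by blast
    then show "(fst x, fst (snd x) \<cdot> fst (snd y), snd (snd y)) \<in> \<Omega>"
      using *(1,2,4) by (simp only: x y \<Omega> fst_conv snd_conv simp_thms)
  qed
  moreover have "((p, K), f, (p, K \<cdot> f)) \<in> \<Omega>" if "p \<in> S" "f \<in> set FF" "nrm K \<le> D" "nrm (K \<cdot> f) \<le> D" for p f K
    using that path_Nil[of E p] mm_one(1)[of "K \<cdot> f"] unfolding \<Omega> by blast
  moreover have "((p, g \<cdot> K), one, (q, K)) \<in> \<Omega>" if "(p, g, q) \<in> E" "nrm K \<le> D" "nrm (g \<cdot> K) \<le> D" for p g q K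
    using that E[OF that(1)] path_edge[OF that(1)] one_FF mm_one(2)[of "g \<cdot> K"] unfolding \<Omega> by metis
  ultimately have "saturated E S D \<Omega>"
    by (auto simp: saturated_def)
  moreover have "finite \<Omega>"
    unfolding \<Omega>_def using assms(1) finite_nrm by (intro finite_subset[OF Collect_subset] finite_cartesian_product) auto
  moreover have "path E s K q" if "((s, K), one, (q, one)) \<in> \<Omega>" for s q K
    using that by (auto simp: \<Omega>)
  ultimately show thesis
    using that by blast
qed

lemma large_enough_exists:
  assumes "finite E"
  shows "\<exists>D. large_enough E T D"
proof -
  define A where "A = insert (nrm T) (insert (1 + 2 * (det2 T * det2 T))
    ((\<lambda>e. nrm (fst (snd e)) * (1 + 2 * (det2 T * det2 T))) ` E))"
  have "finite A"
    using assms by (simp add: A_def)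
  then have "\<forall>x\<in>A. x \<le> Max A"
    by simp
  then show ?thesis
    unfolding large_enough_def A_def by blast
qed

text \<open>Certificates are sound by \<open>saturated_contains_path\<close>. They are complete
  because, if no path exists, the family of true triples from \<open>saturated_exists\<close> omits
  all forbidden ones.\<close>

lemma path_iff_no_certificate:
  assumes "finite E" "finite S" and E: "\<And>s g q. (s, g, q) \<in> E \<Longrightarrow> det2 g \<noteq> 0 \<and> s \<in> S \<and> q \<in> S"
    and I: "I \<subseteq> S" and T: "det2 T \<noteq> 0"
  shows "(\<exists>s\<in>I. \<exists>q\<in>Q. path E s T q) \<longleftrightarrow>
    \<not> (\<exists>D \<Omega>. large_enough E T D \<and> saturated E S D (set \<Omega>) \<and>
      (\<forall>s\<in>I. \<forall>q\<in>Q. ((s, T), one, (q, one)) \<notin> set \<Omega>))"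
proof
  assume "\<exists>s\<in>I. \<exists>q\<in>Q. path E s T q"
  then obtain s q where sq: "s \<in> I" "q \<in> Q" "path E s T q" by blast
  then have "((s, T), one, (q, one)) \<in> set \<Omega>" if "large_enough E T D" "saturated E S D (set \<Omega>)" for D \<Omega>
    using saturated_contains_path[OF that(2,1) _ sq(3)] E T I by auto
  with sq(1,2) show "\<not> (\<exists>D \<Omega>. large_enough E T D \<and> saturated E S D (set \<Omega>) \<and>
      (\<forall>s\<in>I. \<forall>q\<in>Q. ((s, T), one, (q, one)) \<notin> set \<Omega>))"
    by blast
next
  assume *: "\<not> (\<exists>D \<Omega>. large_enough E T D \<and> saturated E S D (set \<Omega>) \<and>
      (\<forall>s\<in>I. \<forall>q\<in>Q. ((s, T), one, (q, one)) \<notin> set \<Omega>))"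
  obtain D where D: "large_enough E T D"
    using large_enough_exists[OF assms(1)] by blast
  obtain \<Omega> where \<Omega>: "saturated E S D \<Omega>" "finite \<Omega>"
    "\<And>s q K. ((s, K), one, (q, one)) \<in> \<Omega> \<Longrightarrow> path E s K q"
    using saturated_exists[OF assms(2), of E D] E by blast
  obtain xs where "set xs = \<Omega>"
    using finite_list[OF \<Omega>(2)] by blast
  with * D \<Omega> show "\<exists>s\<in>I. \<exists>q\<in>Q. path E s T q"
    by metis
qed

section \<open>Deciding the path problem\<close>

lemma Comp_mm [computable]: "Comp f \<Longrightarrow> Comp g \<Longrightarrow> Comp (\<lambda>x. f x \<cdot> g x)"
  unfolding mm_def case_prod_unfold by (intro computable)

lemma Comp_nrm [computable]: "Comp f \<Longrightarrow> Comp (\<lambda>x. nrm (f x))"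
  unfolding nrm_def case_prod_unfold by (intro computable)

lemma Comp_det2 [computable]: "Comp f \<Longrightarrow> Comp (\<lambda>x. det2 (f x))"
  unfolding det2_def case_prod_unfold by (intro computable)

lemma enc_int_less: "\<bar>i\<bar> \<le> D \<Longrightarrow> enc i < Suc (2 * nat D)"
  by (auto simp: enc_int_def int_encode_def sum_encode_def)

text \<open>The entries of \<open>K\<close> are at most \<open>nrm K\<close> in absolute value, so
  the quantifier over matrices becomes four bounded quantifiers over codes of integers.\<close>

lemma Dec_all_nrm [computable]:
  assumes D: "Comp D" and P: "Dec (\<lambda>z. P (fst z) (snd z))"
  shows "Dec (\<lambda>x. \<forall>K. nrm K \<le> D x \<longrightarrow> P x K)"
proof -
  let ?N = "\<lambda>x. Suc (2 * nat (D x))"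
  have "Dec (\<lambda>x. \<forall>a<?N x. \<forall>b<?N x. \<forall>c<?N x. \<forall>d<?N x.
    nrm (dec a, dec b, dec c, dec d) \<le> D x \<longrightarrow> P x (dec a, dec b, dec c, dec d))"
    by (intro computable Comp_comp[OF D] Dec_comp2[OF P] D)
  moreover have "(\<forall>a<?N x. \<forall>b<?N x. \<forall>c<?N x. \<forall>d<?N x.
    nrm (dec a, dec b, dec c, dec d) \<le> D x \<longrightarrow> P x (dec a, dec b, dec c, dec d)) \<longleftrightarrow>
    (\<forall>K. nrm K \<le> D x \<longrightarrow> P x K)" (is "?L \<longleftrightarrow> ?R") for x
  proof
    assume L: ?L
    show ?R
    proof (intro allI impI)
      fix K
      assume K: "nrm K \<le> D x"
      obtain a b c d where [simp]: "K = (a, b, c, d)"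
        by (cases K)
      have "enc a < ?N x" "enc b < ?N x" "enc c < ?N x" "enc d < ?N x"
        using abs_le_nrm[of a b c d "D x"] K by (auto intro!: enc_int_less)
      with L[rule_format, of "enc a" "enc b" "enc c" "enc d"] K show "P x K"
        by simp
    qed
  qed auto
  ultimately show ?thesis by simp
qed

lemma Dec_saturated [computable]:
  assumes "Comp E" "Comp S" "Comp D" "Comp \<Omega>"
  shows "Dec (\<lambda>x. saturated (set (E x)) (set (S x)) (D x) (set (\<Omega> x)))"
  unfolding saturated_def composition_closed_def
  by (intro computable assms[THEN Comp_comp] assms)

lemma Dec_large_enough [computable]:
  assumes "Comp E" "Comp T" "Comp D"
  shows "Dec (\<lambda>x. large_enough (set (E x)) (T x) (D x))"
  unfolding large_enough_def
  by (intro computable assms[THEN Comp_comp] assms)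

text \<open>The first component of the value is \<open>1\<close> iff the list of edges is a path to \<open>q\<close>.\<close>

primrec path_eval :: "('s \<times> mat \<times> 's) list \<Rightarrow> 's \<Rightarrow> ('s \<times> mat \<times> 's) list \<Rightarrow> nat \<times> 's \<times> mat" where
  "path_eval E q [] = (1, q, one)"
| "path_eval E q (e # es) =
    (if e \<in> set E \<and> fst (path_eval E q es) = 1 \<and> fst (snd (path_eval E q es)) = snd (snd e) then 1 else 0,
     fst e, fst (snd e) \<cdot> snd (snd (path_eval E q es)))"

lemma Comp_path_eval [computable]:
  assumes "Comp E" "Comp q" "Comp l"
  shows "Comp (\<lambda>x. path_eval (E x) (q x) (l x))"
proof -
  have "Comp (\<lambda>x. rec_list (1 :: nat, q x, one) (\<lambda>e es r.
    (if e \<in> set (E x) \<and> fst r = 1 \<and> fst (snd r) = snd (snd e) then 1 else 0,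
     fst e, fst (snd e) \<cdot> snd (snd r))) (l x))"
    by (intro computable assms[THEN Comp_comp] assms)
  moreover have "path_eval E q l = rec_list (1 :: nat, q, one) (\<lambda>e es r.
    (if e \<in> set E \<and> fst r = 1 \<and> fst (snd r) = snd (snd e) then 1 else 0,
     fst e, fst (snd e) \<cdot> snd (snd r))) l" for E :: "('b \<times> mat \<times> 'b) list" and q l
    by (induction l) auto
  ultimately show ?thesis by simp
qed

lemma path_iff_path_eval: "path (set E) s g q \<longleftrightarrow> (\<exists>es. path_eval E q es = (1, s, g))"
proof
  show "path (set E) s g q \<Longrightarrow> \<exists>es. path_eval E q es = (1, s, g)"
  proof (induction rule: path.induct)
    case (path_Nil s)
    show ?case by (intro exI[of _ "[]"]) simp
  next
    case (path_Cons s g r h q)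
    then obtain es where "path_eval E q es = (1, r, h)" by blast
    with path_Cons.hyps show ?case
      by (intro exI[of _ "(s, g, r) # es"]) simp
  qed
  have "path_eval E q es = (1, s, g) \<Longrightarrow> path (set E) s g q" for es
  proof (induction es arbitrary: s g)
    case Nil
    then show ?case by (auto intro: path_Nil)
  next
    case (Cons e es)
    obtain s' h r where e: "e = (s', h, r)"
      by (cases e)
    obtain n r' k where p: "path_eval E q es = (n, r', k)"
      by (cases "path_eval E q es")
    have *: "(s, h, r) \<in> set E" "n = 1" "r' = r" "g = h \<cdot> k"
      using Cons.prems unfolding path_eval.simps e p fst_conv snd_conv prod.inject
      by (metis zero_neq_one)+
    show ?case
      unfolding *(4) using *(1) Cons.IH[of r k] p *(2,3) by (intro path_Cons) simp_all
  qed
  then show "\<exists>es. path_eval E q es = (1, s, g) \<Longrightarrow> path (set E) s g q"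
    by blast
qed

text \<open>Two-sided search: a positive certificate is a goal vertex with a list of edges leading
  to it, a negative one a bound \<open>D\<close> with a list of triples.\<close>

lemma Dec_path:
  fixes E :: "'a::enc \<Rightarrow> ('s::enc \<times> mat \<times> 's) list"
  assumes comp: "Comp E" "Comp I" "Comp Q" "Comp T"
  shows "Dec (\<lambda>x. (\<forall>e\<in>set (E x). det2 (fst (snd e)) \<noteq> 0) \<and> det2 (T x) \<noteq> 0 \<and>
    (\<exists>s\<in>set (I x). \<exists>q\<in>set (Q x). path (set (E x)) s (T x) q))"
proof -
  define good where "good x \<longleftrightarrow> (\<forall>e\<in>set (E x). det2 (fst (snd e)) \<noteq> 0) \<and> det2 (T x) \<noteq> 0" for x
  define S where "S x = I x @ map fst (E x) @ map (\<lambda>e. snd (snd e)) (E x)" for x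
  define yes where "yes x c \<longleftrightarrow> good x \<and> fst c \<in> set (Q x) \<and> fst (path_eval (E x) (fst c) (snd c)) = 1 \<and>
    fst (snd (path_eval (E x) (fst c) (snd c))) \<in> set (I x) \<and>
    snd (snd (path_eval (E x) (fst c) (snd c))) = T x" for x c
  \<comment> \<open>If a label or the target is singular, the answer is negative and everything
    counts as a negative certificate; \<open>path_iff_no_certificate\<close> is applied to the
    nonsingular case only.\<close>
  define no where "no x c \<longleftrightarrow> \<not> good x \<or> large_enough (set (E x)) (T x) (fst c) \<and>
    saturated (set (E x)) (set (S x)) (fst c) (set (snd c)) \<and>
    (\<forall>s\<in>set (I x). \<forall>q\<in>set (Q x). ((s, T x), one, (q, one)) \<notin> set (snd c))" for x c
  have good: "Dec good"
    unfolding good_def by (intro computable comp[THEN Comp_comp] comp)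
  have S: "Comp S"
    unfolding S_def by (intro computable comp[THEN Comp_comp] comp)
  have "Dec (\<lambda>z. yes (fst z) (snd z))"
    unfolding yes_def by (intro computable comp[THEN Comp_comp] good[THEN Dec_comp])
  moreover have "Dec (\<lambda>z. no (fst z) (snd z))"
    unfolding no_def by (intro computable comp[THEN Comp_comp] S[THEN Comp_comp] good[THEN Dec_comp])
  moreover have yes: "(\<exists>c. yes x c) \<longleftrightarrow> good x \<and> (\<exists>s\<in>set (I x). \<exists>q\<in>set (Q x). path (set (E x)) s (T x) q)" for x
  proof -
    have "(\<exists>c. yes x c) \<longleftrightarrow> good x \<and> (\<exists>q es s. q \<in> set (Q x) \<and> s \<in> set (I x) \<and> path_eval (E x) q es = (1, s, T x))"
      unfolding yes_def by (metis fst_conv prod.collapse snd_conv)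
    then show ?thesis
      unfolding path_iff_path_eval by blast
  qed
  moreover have "(\<exists>c. yes x c) \<longleftrightarrow> \<not> (\<exists>c. no x c)" for x
  proof (cases "good x")
    case True
    then have "(\<exists>s\<in>set (I x). \<exists>q\<in>set (Q x). path (set (E x)) s (T x) q) \<longleftrightarrow>
      \<not> (\<exists>D \<Omega>. large_enough (set (E x)) (T x) D \<and> saturated (set (E x)) (set (S x)) D (set \<Omega>) \<and>
        (\<forall>s\<in>set (I x). \<forall>q\<in>set (Q x). ((s, T x), one, (q, one)) \<notin> set \<Omega>))"
      by (intro path_iff_no_certificate) (force simp: good_def S_def)+
    with True show ?thesis
      unfolding yes by (auto simp: no_def)
  next
    case False
    then show ?thesis
      by (auto simp: yes_def no_def)
  qed
  ultimately have "Dec (\<lambda>x. \<exists>c. yes x c)"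
    by (intro Dec_of_two_sided_search)
  then show ?thesis
    unfolding yes good_def by (simp add: conj_assoc)
qed

section \<open>From instances to graphs\<close>

text \<open>Mirrors instances by types of class \<open>enc\<close>, arranged so that
  \<open>enc\<close> reproduces \<open>inst_code\<close>. It also contains malformed data, with
  letter codes above 3 or matrices without exactly four entries, which \<open>valid\<close>
  rejects.\<close>

type_synonym raw = "(nat list \<times> (nat \<times> nat \<times> nat) list \<times> nat list) \<times> int list"

definition raw_nfa :: "nfa \<Rightarrow> nat list \<times> (nat \<times> nat \<times> nat) list \<times> nat list" where
  "raw_nfa \<A> = (initials \<A>, map (\<lambda>(p, a, q). (p, letter_code a, q)) (edges \<A>), finals \<A>)"

definition raw_mat :: "mat2 \<Rightarrow> int list" where
  "raw_mat M = [M$1$1, M$1$2, M$2$1, M$2$2]"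

definition raw :: "inst \<Rightarrow> raw list" where
  "raw = map (\<lambda>(\<A>, M). (raw_nfa \<A>, raw_mat M))"

lemma enc_nat_list: "enc (xs :: nat list) = list_encode xs"
  by (simp add: enc_list_def enc_nat_def)

lemma enc_raw: "enc (raw x) = inst_code x"
proof -
  have "enc (raw_nfa \<A>) = nfa_code \<A>" for \<A>
    by (simp add: enc_prod_def raw_nfa_def nfa_code_def enc_nat_list)
      (simp add: enc_list_def comp_def edge_code_def case_prod_unfold enc_prod_def enc_nat_def)
  moreover have "enc (raw_mat M) = mat_code M" for M
    by (simp add: raw_mat_def mat_code_def enc_list_def enc_int_def)
  ultimately show ?thesis
    by (simp add: raw_def inst_code_def enc_list_def comp_def case_prod_unfold enc_prod_def)
qed

definition valid :: "raw list \<Rightarrow> bool" where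
  "valid y \<longleftrightarrow> (\<forall>r\<in>set y. length (snd r) = 4 \<and> (\<forall>e\<in>set (fst (snd (fst r))). fst (snd e) < 4))"

lemma letter_code_less: "letter_code a < 4"
  by (cases a) auto

lemma valid_iff: "valid y \<longleftrightarrow> y \<in> range raw"
proof
  show "y \<in> range raw \<Longrightarrow> valid y"
    by (auto simp: valid_def raw_def raw_nfa_def raw_mat_def letter_code_less)
  have letter: "\<exists>a. n = letter_code a" if "n < 4" for n
  proof -
    have "n = 0 \<or> n = 1 \<or> n = 2 \<or> n = 3"
      using that by auto
    then show ?thesis
      by (metis letter_code.simps)
  qed
  have mat: "\<exists>M. l = raw_mat M" if "length l = 4" for l
  proof -
    obtain a b c d where "l = [a, b, c, d]"
      using \<open>length l = 4\<close> by (auto simp: numeral_eq_Suc length_Suc_conv)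
    then show ?thesis
      by (intro exI[of _ "mat2 a b c d"]) (simp add: raw_mat_def mat2_def)
  qed
  have nfa: "\<exists>\<A>. A = raw_nfa \<A>" if "\<forall>e\<in>set (fst (snd A)). fst (snd e) < 4" for A
  proof -
    obtain I E F where A: "A = (I, E, F)" by (cases A)
    have "\<exists>E'. E = map (\<lambda>(p, a, q). (p, letter_code a, q)) E'"
      using that unfolding A fst_conv snd_conv
    proof (induction E)
      case (Cons e E)
      obtain p n q where e: "e = (p, n, q)" by (cases e)
      obtain a where "n = letter_code a"
        using letter[of n] Cons.prems by (auto simp: e)
      moreover obtain E' where "E = map (\<lambda>(p, a, q). (p, letter_code a, q)) E'"
        using Cons by auto
      ultimately show ?case
        by (intro exI[of _ "(p, a, q) # E'"]) (simp add: e)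
    qed simp
    then obtain E' where "E = map (\<lambda>(p, a, q). (p, letter_code a, q)) E'" by blast
    then show ?thesis
      by (intro exI[of _ "NFA I E' F"]) (simp add: A raw_nfa_def)
  qed
  show "valid y \<Longrightarrow> y \<in> range raw"
  proof (induction y)
    case Nil
    then show ?case
      by (intro range_eqI[of _ _ "[]"]) (simp add: raw_def)
  next
    case (Cons r y)
    obtain \<A> M where "r = (raw_nfa \<A>, raw_mat M)"
      using nfa[of "fst r"] mat[of "snd r"] Cons.prems by (cases r) (auto simp: valid_def)
    moreover obtain x where "y = raw x"
      using Cons by (auto simp: valid_def)
    ultimately show ?case
      by (intro range_eqI[of _ _ "(\<A>, M) # x"]) (simp add: raw_def)
  qed
qed

section \<open>Matrices as quadruples and the layered graph\<close>

definition to_mat :: "mat2 \<Rightarrow> mat" where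
  "to_mat M = (M$1$1, M$1$2, M$2$1, M$2$2)"

lemma to_mat_mult: "to_mat (A ** B) = to_mat A \<cdot> to_mat B"
  by (simp add: to_mat_def mm_def matrix_matrix_mult_def sum_2)

lemma to_mat_one: "to_mat (mat 1) = one"
  by (simp add: to_mat_def one_def mat_def)

lemma to_mat_inject: "to_mat A = to_mat B \<longleftrightarrow> A = B"
  by (auto simp: to_mat_def vec_eq_iff forall_2)

lemma det2_to_mat: "det2 (to_mat M) = det M"
  by (simp add: det2_def to_mat_def det_2)

text \<open>\<open>one\<close> is a default for lists that are too short; nested case distinctions
  match the closure rule \<open>Comp_case_list\<close>.\<close>

definition mat_of_list :: "int list \<Rightarrow> mat" where
  "mat_of_list l = (case l of [] \<Rightarrow> one | a # l1 \<Rightarrow> (case l1 of [] \<Rightarrow> one | b # l2 \<Rightarrow>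
    (case l2 of [] \<Rightarrow> one | c # l3 \<Rightarrow> (case l3 of [] \<Rightarrow> one | d # l4 \<Rightarrow> (a, b, c, d)))))"

lemma mat_of_list_raw_mat: "mat_of_list (raw_mat M) = to_mat M"
  by (simp add: mat_of_list_def raw_mat_def to_mat_def)

definition mat_of_letter_code :: "nat \<Rightarrow> mat" where
  "mat_of_letter_code n = (if n = 0 then (-1, 0, 0, -1) else if n = 1 then (1, 0, 0, -1)
    else if n = 2 then (0, -1, 1, 0) else (0, -1, 1, 1))"

lemma mat_of_letter_code: "mat_of_letter_code (letter_code a) = to_mat (letter_mat a)"
  by (cases a) (simp_all add: mat_of_letter_code_def to_mat_def mat2_def)

lemma to_mat_phi_Cons: "to_mat (phi (a # w)) = to_mat (letter_mat a) \<cdot> to_mat (phi w)"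
  by (simp add: phi_def mat_prod_def to_mat_mult)

lemma to_mat_phi_Nil: "to_mat (phi []) = one"
  by (simp add: phi_def mat_prod_def to_mat_one)

definition first_initials :: "raw list \<Rightarrow> nat list" where
  "first_initials y = (case y of [] \<Rightarrow> [] | r # l \<Rightarrow> fst (fst r))"

text \<open>The first component of a state is the number of automata that are still to come.\<close>

primrec graph :: "raw list \<Rightarrow> ((nat \<times> nat) \<times> mat \<times> (nat \<times> nat)) list" where
  "graph [] = []"
| "graph (r # l) =
    map (\<lambda>e. ((length l, fst e), mat_of_letter_code (fst (snd e)), (length l, snd (snd e)))) (fst (snd (fst r))) @
    concat (map (\<lambda>p. map (\<lambda>q. ((length l, p), mat_of_list (snd r), (length l - 1, q))) (first_initials l))
      (snd (snd (fst r)))) @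
    graph l"

definition starts :: "raw list \<Rightarrow> (nat \<times> nat) list" where
  "starts y = map (\<lambda>p. (length y - 1, p)) (first_initials y)"

text \<open>The last automaton is at level 0. Its matrix labels no edge: it is the right-hand side
  of the equation and becomes the target.\<close>

primrec goals :: "raw list \<Rightarrow> (nat \<times> nat) list \<times> mat" where
  "goals [] = ([], one)"
| "goals (r # l) = (if l = [] then (map (\<lambda>q. (0, q)) (snd (snd (fst r))), mat_of_list (snd r)) else goals l)"

lemma Comp_mat_of_list [computable]: "Comp f \<Longrightarrow> Comp (\<lambda>x. mat_of_list (f x))"
  unfolding mat_of_list_def by (intro computable)

lemma Comp_mat_of_letter_code [computable]: "Comp f \<Longrightarrow> Comp (\<lambda>x. mat_of_letter_code (f x))"
  unfolding mat_of_letter_code_def by (intro computable)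

lemma Comp_first_initials [computable]: "Comp f \<Longrightarrow> Comp (\<lambda>x. first_initials (f x))"
  unfolding first_initials_def by (intro computable)

lemma Comp_starts: "Comp starts"
  unfolding starts_def by (intro computable)

lemma Comp_graph: "Comp graph"
  unfolding graph_def by (intro computable)

lemma Comp_goals: "Comp goals"
  unfolding goals_def by (intro computable)

lemma first_initials_raw: "first_initials (raw x) = (case x of [] \<Rightarrow> [] | y # l \<Rightarrow> initials (fst y))"
  by (cases x) (auto simp: first_initials_def raw_def raw_nfa_def)

lemma length_raw [simp]: "length (raw x) = length x"
  by (simp add: raw_def)

lemma raw_Cons: "raw ((\<A>, M) # x) = (raw_nfa \<A>, raw_mat M) # raw x"
  by (simp add: raw_def)

lemma set_graph_Cons: "set (graph (raw ((\<A>, M) # x))) =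
    (\<lambda>(p, a, q). ((length x, p), to_mat (letter_mat a), (length x, q))) ` set (edges \<A>) \<union>
    (\<lambda>(p, q). ((length x, p), to_mat M, (length x - 1, q))) ` (set (finals \<A>) \<times> set (first_initials (raw x))) \<union>
    set (graph (raw x))"
proof -
  have "set (concat (map (\<lambda>p. map (\<lambda>q. ((length x, p), to_mat M, (length x - 1, q))) qs) ps)) =
    (\<lambda>(p, q). ((length x, p), to_mat M, (length x - 1, q))) ` (set ps \<times> set qs)" for ps qs :: "nat list"
    by auto
  then show ?thesis
    by (simp add: raw_Cons raw_nfa_def mat_of_letter_code mat_of_list_raw_mat image_image case_prod_unfold
      Un_assoc del: set_concat)
qed

lemma graph_levels: "(s, g, q) \<in> set (graph (raw x)) \<Longrightarrow> fst s < length x \<and> fst q < length x"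
proof (induction x)
  case (Cons y x)
  then show ?case
    by (cases y) (auto simp: set_graph_Cons less_Suc_eq)
qed (simp add: raw_def)

text \<open>The edges added for \<open>y\<close> all start at level \<open>length x\<close>, and no
  edge of the remaining graph leads back up to it.\<close>

lemma path_lower_level:
  "path (set (graph (raw (y # x)))) s g q \<Longrightarrow> fst s < length x \<Longrightarrow> path (set (graph (raw x))) s g q"
proof (induction rule: path.induct)
  case (path_Cons s g r h q)
  then have "(s, g, r) \<in> set (graph (raw x))"
    by (cases y) (auto simp: set_graph_Cons)
  with path_Cons graph_levels[OF this] show ?case
    by (auto intro: path.path_Cons)
qed (rule path_Nil)

text \<open>Levels never increase, so a path that starts in the first automaton either stays there
  and is a run, or splits at the one edge by which it leaves.\<close>

lemma path_top_level:
  "path (set (graph (raw ((\<A>, M) # x)))) s g t \<Longrightarrow> fst s = length x \<Longrightarrow>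
    fst t = length x \<and> (\<exists>w. run \<A> (snd s) w (snd t) \<and> g = to_mat (phi w)) \<or>
    (\<exists>w p q h. run \<A> (snd s) w p \<and> p \<in> set (finals \<A>) \<and> q \<in> set (first_initials (raw x)) \<and>
      path (set (graph (raw x))) (length x - 1, q) h t \<and> g = to_mat (phi w) \<cdot> to_mat M \<cdot> h)"
proof (induction rule: path.induct)
  case (path_Nil s)
  then show ?case
    by (intro disjI1 conjI exI[of _ "[]"]) (auto simp: to_mat_phi_Nil)
next
  case (path_Cons s g r h t)
  have "(s, g, r) \<notin> set (graph (raw x))"
    using graph_levels[of s g r x] path_Cons.prems by auto
  with path_Cons.hyps(1) consider
    (letter) p a q where "(p, a, q) \<in> set (edges \<A>)" "s = (length x, p)" "g = to_mat (letter_mat a)" "r = (length x, q)"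
  | (next_level) p q where "p \<in> set (finals \<A>)" "q \<in> set (first_initials (raw x))" "s = (length x, p)"
      "g = to_mat M" "r = (length x - 1, q)"
    by (auto simp: set_graph_Cons)
  then show ?case
  proof cases
    case letter
    from path_Cons.IH letter consider
      (top) w where "fst t = length x" "run \<A> q w (snd t)" "h = to_mat (phi w)"
    | (below) w p' q' k where "run \<A> q w p'" "p' \<in> set (finals \<A>)" "q' \<in> set (first_initials (raw x))"
        "path (set (graph (raw x))) (length x - 1, q') k t" "h = to_mat (phi w) \<cdot> to_mat M \<cdot> k"
      by fastforce
    then show ?thesis
    proof cases
      case top
      with letter show ?thesis
        by (intro disjI1 conjI exI[of _ "a # w"]) (auto simp: to_mat_phi_Cons)
    next
      case below
      with letter show ?thesis
        by (intro disjI2 exI[of _ "a # w"] exI[of _ p'] exI[of _ q'] exI[of _ k])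
          (auto simp: to_mat_phi_Cons mm_assoc)
    qed
  next
    case next_level
    \<comment> \<open>After the last automaton there are no initial states to move to, so the
      crossing edge shows that \<open>length x - 1\<close> is a genuine predecessor.\<close>
    then have "x \<noteq> []"
      by (auto simp: first_initials_def raw_def)
    then have "path (set (graph (raw x))) (length x - 1, q) h t"
      using path_lower_level[OF path_Cons.hyps(2)] next_level by simp
    with next_level show ?thesis
      by (intro disjI2 exI[of _ "[]"] exI[of _ p] exI[of _ q] exI[of _ h]) (simp add: to_mat_phi_Nil)
  qed
qed

lemma path_run:
  "run \<A> p w q \<Longrightarrow> path (set (graph (raw ((\<A>, M) # x)))) (length x, p) (to_mat (phi w)) (length x, q)"
proof (induction w arbitrary: p)
  case Nil
  then show ?case
    by (simp add: to_mat_phi_Nil path_Nil)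
next
  case (Cons a w)
  then obtain r where r: "(p, a, r) \<in> set (edges \<A>)" "run \<A> r w q"
    by auto
  have "((length x, p), to_mat (letter_mat a), (length x, r)) \<in> set (graph (raw ((\<A>, M) # x)))"
    using r(1) by (force simp: set_graph_Cons)
  from path_Cons[OF this Cons.IH[OF r(2)]] show ?case
    by (simp add: to_mat_phi_Cons)
qed

text \<open>The possible values of the left-hand side of the equation. The matrix of the last pair
  does not enter, being the right-hand side.\<close>

fun products :: "inst \<Rightarrow> mat set" where
  "products [] = {}"
| "products [(\<A>, M)] = to_mat ` nfa_subset \<A>"
| "products ((\<A>, M) # y # x) = {to_mat A \<cdot> to_mat M \<cdot> g |A g. A \<in> nfa_subset \<A> \<and> g \<in> products (y # x)}"

lemma nfa_subset_iff: "A \<in> nfa_subset \<A> \<longleftrightarrow>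
    (\<exists>p w q. p \<in> set (initials \<A>) \<and> q \<in> set (finals \<A>) \<and> run \<A> p w q \<and> A = phi w)"
  by (auto simp: nfa_subset_def language_def)

lemma goals_raw: "x \<noteq> [] \<Longrightarrow> goals (raw x) = (map (\<lambda>q. (0, q)) (finals (fst (last x))), to_mat (snd (last x)))"
proof (induction x)
  case (Cons y x)
  then show ?case
    by (cases y; cases x) (auto simp: raw_def raw_nfa_def mat_of_list_raw_mat)
qed simp

text \<open>Induction on the number of automata: \<open>path_top_level\<close> and
  \<open>path_run\<close> translate between one level of the graph and one factor of the
  product.\<close>

lemma path_iff_products:
  assumes "x \<noteq> []"
  shows "(\<exists>s\<in>set (starts (raw x)). \<exists>q\<in>set (fst (goals (raw x))). path (set (graph (raw x))) s g q) \<longleftrightarrow>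
    g \<in> products x"
  using assms
proof (induction x arbitrary: g rule: products.induct)
  case (2 \<A> M)
  have E: "path (set (graph (raw [(\<A>, M)]))) (0, p) g (0, q) \<longleftrightarrow> (\<exists>w. run \<A> p w q \<and> g = to_mat (phi w))" for p q
    using path_top_level[of \<A> M "[]" "(0, p)" g "(0, q)"] path_run[of \<A> p _ q M "[]"]
    by (auto simp: first_initials_raw)
  show ?case
    by (simp add: starts_def first_initials_raw goals_raw E image_iff Bex_def nfa_subset_iff) blast
next
  case (3 \<A> M y x)
  let ?l = "y # x"
  have E: "path (set (graph (raw ((\<A>, M) # ?l)))) (length ?l, p) g (0, q) \<longleftrightarrow>
    (\<exists>w p' q' h. run \<A> p w p' \<and> p' \<in> set (finals \<A>) \<and> q' \<in> set (initials (fst y)) \<and>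
      path (set (graph (raw ?l))) (length x, q') h (0, q) \<and> g = to_mat (phi w) \<cdot> to_mat M \<cdot> h)"
    (is "?L \<longleftrightarrow> ?R") for p q
  proof
    show "?L \<Longrightarrow> ?R"
      using path_top_level[of \<A> M ?l "(length ?l, p)" g "(0, q)"] by (simp add: first_initials_raw)
    assume ?R
    then obtain w p' q' h where *: "run \<A> p w p'" "p' \<in> set (finals \<A>)" "q' \<in> set (initials (fst y))"
      "path (set (graph (raw ?l))) (length x, q') h (0, q)" "g = to_mat (phi w) \<cdot> to_mat M \<cdot> h"
      by blast
    have "((length ?l, p'), to_mat M, (length x, q')) \<in> set (graph (raw ((\<A>, M) # ?l)))"
      using *(2,3) by (force simp: set_graph_Cons[of _ _ ?l] first_initials_raw)
    moreover have "set (graph (raw ?l)) \<subseteq> set (graph (raw ((\<A>, M) # ?l)))"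
      by (auto simp: set_graph_Cons[of _ _ ?l])
    ultimately have "path (set (graph (raw ((\<A>, M) # ?l)))) (length ?l, p') (to_mat M \<cdot> h) (0, q)"
      using path_Cons path_mono[OF *(4)] by metis
    from path_trans[OF path_run[OF *(1)] this] show ?L
      by (simp only: *(5) mm_assoc)
  qed
  have IH: "(\<exists>p\<in>set (initials (fst y)). \<exists>q\<in>set (finals (fst (last ?l))).
    path (set (graph (raw ?l))) (length x, p) h (0, q)) \<longleftrightarrow> h \<in> products ?l" for h
    using 3(1)[of h] by (simp add: starts_def first_initials_raw goals_raw)
  show ?case
    by (simp add: starts_def first_initials_raw goals_raw E[simplified] nfa_subset_iff flip: IH) blast
qed simp

lemma products_iff:
  "x \<noteq> [] \<Longrightarrow> g \<in> products x \<longleftrightarrow>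
    (\<exists>A. (\<forall>i<length x. A i \<in> nfa_subset (fst (x ! i))) \<and>
      g = to_mat (mat_prod (map (\<lambda>i. A i ** snd (x ! i)) [0..<length x - 1]) ** A (length x - 1)))"
proof (induction x arbitrary: g rule: products.induct)
  case (2 \<A> M)
  show ?case
    by (auto simp: mat_prod_def image_iff)
next
  case (3 \<A> M y x)
  let ?l = "y # x"
  let ?P = "\<lambda>x A. mat_prod (map (\<lambda>i. A i ** snd (x ! i)) [0..<length x - 1]) ** A (length x - 1)"
  have step: "?P ((\<A>, M) # ?l) A = A 0 ** M ** ?P ?l (\<lambda>i. A (Suc i))" for A
  proof -
    have "[0..<length ((\<A>, M) # ?l) - 1] = 0 # map Suc [0..<length ?l - 1]"
      by (simp add: map_Suc_upt upt_conv_Cons del: upt_Suc)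
    then show ?thesis
      by (simp add: mat_prod_def comp_def matrix_mul_assoc del: upt_Suc)
  qed
  show ?case (is "_ \<longleftrightarrow> ?R")
  proof
    assume "g \<in> products ((\<A>, M) # ?l)"
    then obtain A0 h where *: "A0 \<in> nfa_subset \<A>" "h \<in> products ?l" "g = to_mat A0 \<cdot> to_mat M \<cdot> h"
      by auto
    then obtain A where A: "\<forall>i<length ?l. A i \<in> nfa_subset (fst (?l ! i))" "h = to_mat (?P ?l A)"
      using 3(1)[of h] by blast
    \<comment> \<open>Prepends \<open>A0\<close> to the choice made for the remaining automata,
      shifting their indices by one.\<close>
    let ?A = "case_nat A0 A"
    have "g = to_mat (?P ((\<A>, M) # ?l) ?A)"
      unfolding step *(3) A(2) to_mat_mult by (simp add: mm_assoc)
    moreover have "?A i \<in> nfa_subset (fst (((\<A>, M) # ?l) ! i))" if "i < length ((\<A>, M) # ?l)" for i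
      using that A(1) *(1) by (cases i) auto
    ultimately show ?R
      by blast
  next
    assume ?R
    then obtain A where A: "\<forall>i<length ((\<A>, M) # ?l). A i \<in> nfa_subset (fst (((\<A>, M) # ?l) ! i))"
      "g = to_mat (?P ((\<A>, M) # ?l) A)"
      by blast
    have "to_mat (?P ?l (\<lambda>i. A (Suc i))) \<in> products ?l"
      using 3(1)[of "to_mat (?P ?l (\<lambda>i. A (Suc i)))"] A(1) by (auto intro!: exI[of _ "\<lambda>i. A (Suc i)"])
    moreover have "A 0 \<in> nfa_subset \<A>"
      using A(1) by force
    ultimately show "g \<in> products ((\<A>, M) # ?l)"
      using A(2) unfolding step to_mat_mult products.simps by blast
  qed
qed simp

lemma solution_iff_products:
  assumes "x \<noteq> []"
  shows "(\<exists>A. solution x A) \<longleftrightarrow> to_mat (snd (last x)) \<in> products x"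
  unfolding products_iff[OF assms] solution_def Let_def to_mat_inject last_conv_nth[OF assms]
  by (intro ex_cong1 conj_cong refl) (rule eq_commute)

theorem theorem4:
  "decidable_set (inst_code `
     {x. length x \<ge> 1 \<and> (\<forall>(\<A>, M)\<in>set x. det M \<noteq> 0) \<and> (\<exists>A. solution x A)})"
proof (rule decidable_set_Dec)
  \<comment> \<open>A condition on raw data, with its last conjunct in the shape that
    \<open>Dec_path\<close> decides. For nonsingular instances the determinant conditions on labels
    and target are derived below.\<close>
  define P where "P y \<longleftrightarrow> valid y \<and> y \<noteq> [] \<and> (\<forall>r\<in>set y. det2 (mat_of_list (snd r)) \<noteq> 0) \<and>
    ((\<forall>e\<in>set (graph y). det2 (fst (snd e)) \<noteq> 0) \<and> det2 (snd (goals y)) \<noteq> 0 \<and>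
    (\<exists>s\<in>set (starts y). \<exists>q\<in>set (fst (goals y)). path (set (graph y)) s (snd (goals y)) q))" for y
  have P: "Dec P"
    unfolding P_def valid_def
    by (intro computable Dec_path Comp_graph Comp_starts Comp_comp[OF Comp_goals] Comp_comp[OF Comp_graph])
  have unit: "det (letter_mat a) \<noteq> 0" for a
    using letter_mat_in_GL2Z[of a] by (auto simp: GL2Z_def)
  have graph: "det2 (fst (snd e)) \<noteq> 0" if "\<forall>(\<A>, M)\<in>set x. det M \<noteq> 0" "e \<in> set (graph (raw x))" for x e
    using that
  proof (induction x)
    case (Cons y x)
    then show ?case
      by (cases y) (auto simp: set_graph_Cons unit det2_to_mat)
  qed (simp add: raw_def)
  have P_raw: "P (raw x) \<longleftrightarrow> length x \<ge> 1 \<and> (\<forall>(\<A>, M)\<in>set x. det M \<noteq> 0) \<and> (\<exists>A. solution x A)" for x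
  proof -
    have valid: "valid (raw x)" and Nil: "raw x \<noteq> [] \<longleftrightarrow> length x \<ge> 1"
      by (auto simp: valid_iff raw_def Suc_le_eq)
    have dets: "(\<forall>r\<in>set (raw x). det2 (mat_of_list (snd r)) \<noteq> 0) \<longleftrightarrow> (\<forall>(\<A>, M)\<in>set x. det M \<noteq> 0)"
      by (simp add: raw_def mat_of_list_raw_mat det2_to_mat case_prod_unfold)
    show ?thesis
    proof (cases "x \<noteq> [] \<and> (\<forall>(\<A>, M)\<in>set x. det M \<noteq> 0)")
      case True
      then have "det2 (snd (goals (raw x))) \<noteq> 0"
        using last_in_set[of x] by (fastforce simp: goals_raw det2_to_mat)
      moreover have "(\<exists>A. solution x A) \<longleftrightarrow> snd (goals (raw x)) \<in> products x"
        using True solution_iff_products[of x] by (simp add: goals_raw)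
      ultimately show ?thesis
        unfolding P_def dets Nil using valid True graph[of x] path_iff_products[of x "snd (goals (raw x))"] by blast
    next
      case False
      then show ?thesis
        unfolding P_def dets Nil by (auto simp: Suc_le_eq)
    qed
  qed
  \<comment> \<open>Every number decodes to some raw list; the valid ones are exactly the codes of
    instances, and all other numbers are rejected.\<close>
  have "n \<in> inst_code ` {x. length x \<ge> 1 \<and> (\<forall>(\<A>, M)\<in>set x. det M \<noteq> 0) \<and> (\<exists>A. solution x A)} \<longleftrightarrow> P (dec n)" for n
  proof
    assume "P (dec n)"
    then obtain x where x: "dec n = raw x"
      by (auto simp: P_def valid_iff)
    then have "n = inst_code x"
      by (metis enc_dec enc_raw)
    with \<open>P (dec n)\<close> x P_raw[of x] show "n \<in> inst_code ` {x. length x \<ge> 1 \<and> (\<forall>(\<A>, M)\<in>set x. det M \<noteq> 0) \<and> (\<exists>A. solution x A)}"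
      by auto
  next
    assume "n \<in> inst_code ` {x. length x \<ge> 1 \<and> (\<forall>(\<A>, M)\<in>set x. det M \<noteq> 0) \<and> (\<exists>A. solution x A)}"
    then obtain x where "n = inst_code x" "P (raw x)"
      using P_raw by blast
    then show "P (dec n)"
      by (simp flip: enc_raw)
  qed
  then show "Dec (\<lambda>n. n \<in> inst_code ` {x. length x \<ge> 1 \<and> (\<forall>(\<A>, M)\<in>set x. det M \<noteq> 0) \<and> (\<exists>A. solution x A)})"
    using Dec_comp[OF P Comp_dec[OF Comp_id]] by simp
qed

end
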